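(* Let $s>0$. There is a constant $C>0$ (depending only on $s$ and $\psi$) such that for every radially symmetric $f\in H^s_x(\mathbb{R}^4)$, $$\biggl\| |x|^{\frac32}\Bigl( \sum_{k\in\mathbb{Z}^4} |P_kf(x)|^2 \Bigr)^{\frac12} \biggr\|_{L^\infty_x(\mathbb{R}^4)} \leq C \|f\|_{H^s_x(\mathbb{R}^4)}.$$
   Context: Fix an even, non-negative $\psi\in C_c^\infty(\mathbb{R}^4)$ with $\operatorname{supp}\psi\subseteq B(0,2)$ and $\sum_{k\in\mathbb{Z}^4}\psi(\xi-k)=1$ for all $\xi\in\mathbb{R}^4$. For $k\in\mathbb{Z}^4$ the unit-scale projection is $P_kf=\mathcal{F}^{-1}(\psi(\cdot-k)\hat f)$. *)

theory Defs
  imports "HOL-Analysis.Analysis" "HOL-Probability.Essential_Supremum"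
begin

fun higher_differentiable :: "nat \<Rightarrow> ('a::euclidean_space \<Rightarrow> real) \<Rightarrow> bool" where
  "higher_differentiable 0 f \<longleftrightarrow> continuous_on UNIV f"
| "higher_differentiable (Suc n) f \<longleftrightarrow>
     (\<forall>x. f differentiable (at x)) \<and>
     (\<forall>v. higher_differentiable n (\<lambda>x. frechet_derivative f (at x) v))"

definition smooth :: "('a::euclidean_space \<Rightarrow> real) \<Rightarrow> bool" where
  "smooth f \<longleftrightarrow> (\<forall>n. higher_differentiable n f)"

definition int_lattice :: "(real ^ 'n) set" where
  "int_lattice = {k. \<forall>i. k $ i \<in> \<int>}"

text \<open>Elements of \<open>L\<^sup>2\<close> and \<open>H\<^sup>s\<close> are represented by Borel measurable functions; all notions
  below depend on such a function only up to null sets.\<close>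

definition square_integrable :: "('a::euclidean_space \<Rightarrow> complex) \<Rightarrow> bool" where
  "square_integrable f \<longleftrightarrow>
     f \<in> borel_measurable lborel \<and> integrable lborel (\<lambda>x. (norm (f x))\<^sup>2)"

definition radial :: "('a::euclidean_space \<Rightarrow> complex) \<Rightarrow> bool" where
  "radial f \<longleftrightarrow> (\<exists>F. AE x in lborel. f x = F (norm x))"

text \<open>The Fourier transform is normalised to be unitary, with phase \<open>exp (- \<i> x \<bullet> \<xi>)\<close>. The two
  integrals are the transform and its inverse for integrable functions.\<close>

definition fourier_integral :: "('a::euclidean_space \<Rightarrow> complex) \<Rightarrow> 'a \<Rightarrow> complex" where
  "fourier_integral f \<xi> =
     complex_of_real ((1 / sqrt (2 * pi)) ^ DIM('a)) * (LINT x|lborel. cis (- (x \<bullet> \<xi>)) * f x)"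

definition inverse_fourier_integral :: "('a::euclidean_space \<Rightarrow> complex) \<Rightarrow> 'a \<Rightarrow> complex" where
  "inverse_fourier_integral g x =
     complex_of_real ((1 / sqrt (2 * pi)) ^ DIM('a)) * (LINT \<xi>|lborel. cis (x \<bullet> \<xi>) * g \<xi>)"

text \<open>On \<open>L\<^sup>2\<close> the transform is the limit in \<open>L\<^sup>2\<close>, as \<open>R\<close> tends to infinity, of the transforms of
  the truncations of \<open>f\<close> to the ball of radius \<open>R\<close>. By Plancherel's theorem the limit \<open>g\<close> exists
  for every \<open>f\<close> in \<open>L\<^sup>2\<close>; it is unique up to null sets.\<close>

definition has_fourier_transform ::
    "('a::euclidean_space \<Rightarrow> complex) \<Rightarrow> ('a \<Rightarrow> complex) \<Rightarrow> bool" where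
  "has_fourier_transform f g \<longleftrightarrow>
     square_integrable f \<and> square_integrable g \<and>
     ((\<lambda>R::real. \<integral>\<^sup>+ \<xi>. ennreal ((norm (g \<xi> -
         fourier_integral (\<lambda>x. indicator (ball 0 R) x * f x) \<xi>))\<^sup>2) \<partial>lborel) \<longlongrightarrow> 0) at_top"

definition fourier :: "('a::euclidean_space \<Rightarrow> complex) \<Rightarrow> 'a \<Rightarrow> complex" where
  "fourier f = (SOME g. has_fourier_transform f g)"

text \<open>\<open>H\<^sup>s\<close> for \<open>s \<ge> 0\<close>, where it is a subspace of \<open>L\<^sup>2\<close>.\<close>

definition sobolev :: "real \<Rightarrow> ('a::euclidean_space \<Rightarrow> complex) set" where
  "sobolev s = {f. \<exists>g. has_fourier_transform f g \<and>
     integrable lborel (\<lambda>\<xi>. (1 + (norm \<xi>)\<^sup>2) powr s * (norm (g \<xi>))\<^sup>2)}"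

definition sobolev_norm :: "real \<Rightarrow> ('a::euclidean_space \<Rightarrow> complex) \<Rightarrow> real" where
  "sobolev_norm s f =
     sqrt (LINT \<xi>|lborel. (1 + (norm \<xi>)\<^sup>2) powr s * (norm (fourier f \<xi>))\<^sup>2)"

text \<open>For \<open>\<psi>\<close> bounded with bounded support and \<open>f\<close> in \<open>L\<^sup>2\<close> the function
  \<open>\<psi> (\<xi> - k) * fourier f \<xi>\<close> is integrable, so its inverse transform is given by the integral.\<close>

definition unit_proj ::
    "('a::euclidean_space \<Rightarrow> real) \<Rightarrow> 'a \<Rightarrow> ('a \<Rightarrow> complex) \<Rightarrow> 'a \<Rightarrow> complex" where
  "unit_proj \<psi> k f =
     inverse_fourier_integral (\<lambda>\<xi>. complex_of_real (\<psi> (\<xi> - k)) * fourier f \<xi>)"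

definition ennreal_sqrt :: "ennreal \<Rightarrow> ennreal" where
  "ennreal_sqrt x = (if x = \<infinity> then \<infinity> else ennreal (sqrt (enn2real x)))"

text \<open>Valued in \<^typ>\<open>ennreal\<close>, so that a divergent sum gives \<open>\<infinity>\<close> rather than \<open>0\<close>.\<close>

definition square_function ::
    "(real ^ 'n \<Rightarrow> real) \<Rightarrow> (real ^ 'n \<Rightarrow> complex) \<Rightarrow> real ^ 'n \<Rightarrow> ennreal" where
  "square_function \<psi> f x =
     ennreal_sqrt (\<Sum>\<^sub>\<infinity>k\<in>int_lattice. ennreal ((norm (unit_proj \<psi> k f x))\<^sup>2))"

end

theory Submission
  imports Defs "HOL-Probability.Characteristic_Functions" "HOL-Probability.Sinc_Integral"
begin

text \<open>The estimate already holds with the \<open>L\<^sup>2\<close> norm on the right-hand side. With \<open>K = exp_kernel\<close>, the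
  product of one-sided exponentials, integration by parts along the coordinate axes writes
  \<open>\<psi> = K * K * K * g\<close> for a test function \<open>g\<close>. Moving the three factors \<open>K\<close> onto \<open>fourier f\<close> bounds
  \<open>\<Sum>k. |P\<^sub>k f(x)|\<^sup>2\<close> by a constant times the average of \<open>|f(x - y)|\<^sup>2\<close> against
  \<open>\<Prod>i. (1 + y\<^sub>i\<^sup>2) ^ (- 3)\<close>: only the Fourier transform of the Cauchy density enters, as the
  autocorrelation of \<open>K\<close>. For radial \<open>f\<close> this average is \<open>O(|x| ^ (- 3))\<close> times the square of the \<open>L\<^sup>2\<close> norm,
  because about \<open>|x| ^ 3\<close> rotated copies of the unit ball around \<open>x\<close> fit on the sphere through \<open>x\<close>
  with bounded overlap. As \<open>P\<^sub>k f(x)\<close> for finitely many \<open>k\<close> depends only on \<open>fourier f\<close> in a ball, \<open>f\<close>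
  may be replaced by the inverse transform of a truncation of \<open>fourier f\<close>, so that neither Fourier
  inversion nor the full Plancherel theorem is needed.\<close>

text \<open>The number of factors \<open>K\<close> is matched to the dimension. The copies on the
  sphere are indexed by a grid in three of the four coordinates, and summing over each grid
  coordinate consumes one factor \<open>1 / (1 + |y|^2)\<close>. Each \<open>K\<close> supplies one:
  the squared modulus of its transform is \<open>cauchy_weight 1\<close>, which is at most
  \<open>1 / (1 + |y|^2)\<close>. Two properties single out \<open>K\<close>. It is the fundamental
  solution of the product over the axes of \<open>1 + d/dx_b\<close>, so
  \<open>\<psi> = K * g\<close> is solved by applying this operator to \<open>\<psi>\<close>, which
  keeps smoothness and bounded support. And Plancherel for a correlation with \<open>K\<close> is a
  computation: the integral of its square and the weighted integral of the squared transform are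
  quadratic forms in the same function, with kernels that agree up to a power of
  \<open>2 * pi\<close>. What is still needed from Plancherel is one inequality for integrable
  functions, obtained by letting the width of the Cauchy weight tend to infinity. Radial symmetry
  enters only as rotation invariance of \<open>fourier f\<close> almost everywhere.\<close>

lemma borel_measurable_cis [measurable]: "cis \<in> borel_measurable borel"
  by (intro borel_measurable_continuous_onI continuous_intros)

lemma borel_measurable_cnj [measurable]: "cnj \<in> borel_measurable borel"
  by (intro borel_measurable_continuous_onI continuous_intros)

section \<open>The one-sided exponential and its transform\<close>

abbreviation exp_density :: "real \<Rightarrow> real" where
  "exp_density \<equiv> exponential_density 1"

lemma exp_density_eq: "exp_density t = indicator {0..} t * exp (- t)"
  by (auto simp: exponential_density_def indicator_def)

lemma integrable_exp_density: "integrable lborel exp_density"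
  and integral_exp_density: "(LINT t|lborel. exp_density t) = 1"
proof -
  interpret prob_space "density lborel exp_density"
    by (rule prob_space_exponential_density) simp
  have *: "(\<integral>\<^sup>+t. ennreal (exp_density t) \<partial>lborel) = 1"
    using emeasure_space_1 by (simp add: emeasure_density)
  show 1: "integrable lborel exp_density"
    by (rule integrableI_nonneg) (auto simp: *)
  show "(LINT t|lborel. exp_density t) = 1"
    using nn_integral_eq_integral[OF 1] * by (simp add: integral_nonneg_AE)
qed

text \<open>With \<open>z = - 1 + \<i> * y\<close> the integrand on the half line is
  \<open>exp (t * z)\<close>, with antiderivative \<open>exp (t * z) / z\<close>. The intervals
  \<open>{0..n}\<close> exhaust the half line by dominated convergence, and only the endpoint
  \<open>0\<close> survives because \<open>Re z = - 1\<close>.\<close>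

lemma fourier_exp_density:
  "(LINT t|lborel. complex_of_real (exp_density t) * cis (t * y)) = 1 / (1 - \<i> * y)"
proof -
  define z where "z = - 1 + \<i> * complex_of_real y"
  have nz: "z \<noteq> 0" by (auto simp: z_def complex_eq_iff)
  let ?f = "\<lambda>t::real. exp (of_real t * z)"
  have expeq: "exp (of_real t * z) = complex_of_real (exp (- t)) * cis (t * y)" for t
    by (simp add: z_def cis_conv_exp exp_of_real[symmetric] exp_add[symmetric] algebra_simps)
  have int: "integrable lborel (\<lambda>t. complex_of_real (exp_density t) * cis (t * y))"
    by (rule Bochner_Integration.integrable_bound[OF integrable_exp_density])
       (auto simp: norm_mult)
  have "(\<lambda>n. LINT t|lborel. indicator {0..real n} t *\<^sub>R ?f t) \<longlonglongrightarrow>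
      (LINT t|lborel. complex_of_real (exp_density t) * cis (t * y))"
  proof (rule integral_dominated_convergence[where w = exp_density])
    show "AE t in lborel. (\<lambda>n. indicator {0..real n} t *\<^sub>R ?f t) \<longlonglongrightarrow>
        complex_of_real (exp_density t) * cis (t * y)"
    proof (intro AE_I2)
      fix t :: real
      obtain N :: nat where N: "t \<le> N" using real_arch_simple by blast
      have "\<forall>\<^sub>F n in sequentially. indicator {0..real n} t *\<^sub>R ?f t =
          complex_of_real (exp_density t) * cis (t * y)"
        using eventually_ge_at_top[of N]
        by eventually_elim (use N in \<open>auto simp: exp_density_eq expeq indicator_def\<close>)
      then show "(\<lambda>n. indicator {0..real n} t *\<^sub>R ?f t) \<longlonglongrightarrow>
          complex_of_real (exp_density t) * cis (t * y)"
        by (rule tendsto_eventually)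
    qed
    show "AE t in lborel. norm (indicator {0..real n} t *\<^sub>R ?f t) \<le> exp_density t" for n
      by (auto simp: exp_density_eq expeq indicator_def norm_mult)
  qed (auto simp: integrable_exp_density)
  moreover have "(LINT t|lborel. indicator {0..real n} t *\<^sub>R ?f t) = (?f n - 1) / z" for n
  proof -
    have "(LINT t|lborel. indicator {0..real n} t *\<^sub>R ?f t) = ?f n / z - ?f 0 / z"
    proof (rule integral_FTC_atLeastAtMost)
      fix t :: real
      have "((\<lambda>w. exp (w * z) / z) has_field_derivative exp (of_real t * z)) (at (of_real t))"
        using nz by (auto intro!: derivative_eq_intros)
      then show "((\<lambda>t. ?f t / z) has_vector_derivative ?f t) (at t within {0..real n})"
        by (rule has_vector_derivative_real_field)
    qed (auto intro!: continuous_intros)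
    then show ?thesis by (simp add: diff_divide_distrib)
  qed
  moreover have "(\<lambda>n. (?f (real n) - 1) / z) \<longlonglongrightarrow> (0 - 1) / z"
  proof -
    have "(\<lambda>n. norm (?f (real n))) \<longlonglongrightarrow> 0"
      unfolding expeq norm_mult norm_of_real norm_cis
      using filterlim_compose[OF exp_at_bot filterlim_compose[OF filterlim_uminus_at_bot_at_top filterlim_real_sequentially]]
      by simp
    then show ?thesis
      by (intro tendsto_intros nz) (rule tendsto_norm_zero_cancel)
  qed
  ultimately have "(LINT t|lborel. complex_of_real (exp_density t) * cis (t * y)) = (0 - 1) / z"
    by (simp only: LIMSEQ_unique)
  also have "\<dots> = 1 / (1 - \<i> * y)"
    using nz by (simp add: field_simps z_def)
  finally show ?thesis .
qed

section \<open>The Fourier transform of the Cauchy density\<close>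

lemma integrable_pair_mult:
  fixes f :: "'a \<Rightarrow> 'c::{real_normed_field, banach, second_countable_topology}"
  assumes "sigma_finite_measure M" "sigma_finite_measure N" and f: "integrable M f" and g: "integrable N g"
  shows "integrable (M \<Otimes>\<^sub>M N) (\<lambda>(x, y). f x * g y)"
proof -
  interpret pair_sigma_finite M N
    using assms by (simp add: pair_sigma_finite_def)
  have [measurable]: "f \<in> borel_measurable M" "g \<in> borel_measurable N"
    using f g by auto
  show ?thesis
    by (rule Fubini_integrable) (use f g in \<open>auto simp: norm_mult\<close>)
qed

text \<open>The reflected half line contributes the transform at \<open>- y\<close>, and
  \<open>1 / (1 - \<i> * y) + 1 / (1 + \<i> * y) = 2 / (1 + y^2)\<close>.\<close>

lemma fourier_exp_abs:
  "(LINT t|lborel. complex_of_real (exp (- \<bar>t\<bar>)) * cis (t * y)) = of_real (2 / (1 + y\<^sup>2))"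
  and integrable_exp_abs: "integrable lborel (\<lambda>t::real. exp (- \<bar>t\<bar>))"
proof -
  have int: "integrable lborel (\<lambda>t. complex_of_real (exp_density t) * cis (t * y))" for y
    by (rule Bochner_Integration.integrable_bound[OF integrable_exp_density])
       (auto simp: norm_mult)
  have neg: "integrable lborel (\<lambda>t. exp_density (- t))"
    "integrable lborel (\<lambda>t. complex_of_real (exp_density (- t)) * cis (t * y))"
    using lborel_integrable_real_affine[OF integrable_exp_density, of "-1" 0]
      lborel_integrable_real_affine[OF int[of "- y"], of "-1" 0] by simp_all
  \<comment> \<open>At \<open>t = 0\<close> the left side is 2 and the right side 1.\<close>
  have AE: "AE t in lborel. exp_density t + exp_density (- t) = exp (- \<bar>t\<bar>)"
    using AE_lborel_singleton[of "0::real"]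
    by eventually_elim (auto simp: exp_density_eq indicator_def)
  have "integrable lborel (\<lambda>t. exp_density t + exp_density (- t))"
    using neg(1) integrable_exp_density by auto
  then show "integrable lborel (\<lambda>t::real. exp (- \<bar>t\<bar>))"
    by (subst integrable_cong_AE[where g = "\<lambda>t. exp_density t + exp_density (- t)"]) (use AE in auto)
  have "(LINT t|lborel. complex_of_real (exp (- \<bar>t\<bar>)) * cis (t * y)) =
      (LINT t|lborel. complex_of_real (exp_density t) * cis (t * y) + complex_of_real (exp_density (- t)) * cis (t * y))"
    by (rule integral_cong_AE; (measurable)?) (use AE in \<open>auto elim!: eventually_mono simp: distrib_right[symmetric] simp flip: of_real_add\<close>)
  also have "\<dots> = (LINT t|lborel. complex_of_real (exp_density t) * cis (t * y)) +
      (LINT t|lborel. complex_of_real (exp_density (- t)) * cis (t * y))"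
    using int neg by (intro Bochner_Integration.integral_add)
  also have "(LINT t|lborel. complex_of_real (exp_density (- t)) * cis (t * y)) =
      (LINT t|lborel. complex_of_real (exp_density t) * cis (t * (- y)))"
    by (subst lborel_integral_real_affine[where c = "-1" and t = 0]) auto
  also have "(LINT t|lborel. complex_of_real (exp_density t) * cis (t * y)) +
      (LINT t|lborel. complex_of_real (exp_density t) * cis (t * (- y))) = of_real (2 / (1 + y\<^sup>2))"
  proof -
    have "1 - \<i> * complex_of_real y \<noteq> 0" "1 + \<i> * complex_of_real y \<noteq> 0"
      by (auto simp: complex_eq_iff)
    moreover have "1 + complex_of_real y ^ 2 = (1 - \<i> * y) * (1 + \<i> * y)"
      by (simp add: algebra_simps power2_eq_square)
    ultimately show ?thesis
      unfolding fourier_exp_density by (simp add: add_frac_eq)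
  qed
  finally show "(LINT t|lborel. complex_of_real (exp (- \<bar>t\<bar>)) * cis (t * y)) = of_real (2 / (1 + y\<^sup>2))" .
qed

lemma integrable_cauchy: "integrable lborel (\<lambda>y::real. 1 / (1 + y\<^sup>2))"
  using integrable_inverse_1_plus_square
  by (simp add: set_integrable_def einterval_def inverse_eq_divide)

lemma integral_cis_gauss:
  assumes "\<sigma> > 0"
  shows "(LINT y|lborel. cis (y * a) * complex_of_real (exp (- (\<sigma> * y)\<^sup>2 / 2))) =
     of_real (sqrt (2 * pi) / \<sigma> * exp (- (a / \<sigma>)\<^sup>2 / 2))"
proof -
  have "char std_normal_distribution (a / \<sigma>) =
      (LINT y|lborel. std_normal_density y *\<^sub>R cis (y * (a / \<sigma>)))"
    unfolding char_def by (subst integral_density) (auto simp: cis_conv_exp mult_ac)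
  also have "\<dots> = \<bar>\<sigma>\<bar> *\<^sub>R (LINT y|lborel. std_normal_density (\<sigma> * y) *\<^sub>R cis (y * a))"
    using assms by (subst lborel_integral_real_affine[where c = \<sigma> and t = 0]) auto
  also have "\<dots> = (\<sigma> / sqrt (2 * pi)) *\<^sub>R (LINT y|lborel. cis (y * a) * complex_of_real (exp (- (\<sigma> * y)\<^sup>2 / 2)))"
  proof -
    have "std_normal_density (\<sigma> * y) *\<^sub>R cis (y * a) =
        (1 / sqrt (2 * pi)) *\<^sub>R (cis (y * a) * complex_of_real (exp (- (\<sigma> * y)\<^sup>2 / 2)))" for y
      by (simp add: std_normal_density_def scaleR_conv_of_real)
    then show ?thesis
      using assms by (simp only: integral_scaleR_right) simp
  qed
  finally have *: "complex_of_real (exp (- (a / \<sigma>)\<^sup>2 / 2)) = 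
     (\<sigma> / sqrt (2 * pi)) *\<^sub>R (LINT y|lborel. cis (y * a) * complex_of_real (exp (- (\<sigma> * y)\<^sup>2 / 2)))"
    by (simp add: char_std_normal_distribution)
  have "complex_of_real (sqrt (2 * pi) / \<sigma> * exp (- (a / \<sigma>)\<^sup>2 / 2)) =
      (sqrt (2 * pi) / \<sigma>) *\<^sub>R complex_of_real (exp (- (a / \<sigma>)\<^sup>2 / 2))"
    by (simp add: scaleR_conv_of_real)
  also have "\<dots> = (LINT y|lborel. cis (y * a) * complex_of_real (exp (- (\<sigma> * y)\<^sup>2 / 2)))"
    unfolding * using assms by simp
  finally show ?thesis by simp
qed

lemma integrable_gauss:
  assumes "\<sigma> > 0"
  shows "integrable lborel (\<lambda>y::real. exp (- (\<sigma> * y)\<^sup>2 / 2))"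
proof -
  have "integrable lborel (\<lambda>y. sqrt (2 * pi) * std_normal_density (0 + \<sigma> * y))"
    using assms by (intro integrable_mult_right lborel_integrable_real_affine integrable_normal_density) auto
  then show ?thesis
    by (simp add: std_normal_density_def)
qed

text \<open>Fourier inversion by hand for this single function. Writing \<open>1 / (1 + y^2)\<close>
  as half the transform of \<open>exp (- |t|)\<close> gives a double integral that converges
  absolutely only thanks to the Gaussian factor. With it Fubini applies, the
  \<open>y\<close>-integral is Gaussian, and the result is \<open>pi\<close> times a Gaussian
  average of \<open>exp (- |t|)\<close> around \<open>\<xi>\<close> at scale
  \<open>\<sigma>\<close>.\<close>

lemma fourier_cauchy_regularised:
  assumes "\<sigma> > 0"
  shows "(LINT y|lborel. cis (- (y * \<xi>)) * of_real (1 / (1 + y\<^sup>2)) * of_real (exp (- (\<sigma> * y)\<^sup>2 / 2))) =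
     complex_of_real (pi * (LINT z|lborel. exp (- \<bar>\<xi> + \<sigma> * z\<bar>) * std_normal_density z))"
proof -
  let ?G = "\<lambda>y. complex_of_real (exp (- (\<sigma> * y)\<^sup>2 / 2))"
  let ?E = "\<lambda>t. complex_of_real (exp (- \<bar>t\<bar>))"
  define r where "r = sqrt (2 * pi)"
  have r: "r \<noteq> 0" "r * r = 2 * pi"
    by (simp_all add: r_def)
  have cis_split: "cis (y * (t - \<xi>)) = cis (- (y * \<xi>)) * cis (t * y)" for y t
    by (simp add: cis_mult algebra_simps)
  let ?F = "\<lambda>y t. ?G y * ?E t * cis (y * (t - \<xi>))"
  have int: "integrable (lborel \<Otimes>\<^sub>M lborel) (case_prod ?F)"
    by (rule Bochner_Integration.integrable_bound[OF integrable_pair_mult[OF _ _ integrable_gauss[OF assms] integrable_exp_abs]])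
       (auto simp: norm_mult lborel.sigma_finite_measure_axioms)
  have "(LINT y|lborel. cis (- (y * \<xi>)) * of_real (1 / (1 + y\<^sup>2)) * ?G y) =
     (LINT y|lborel. LINT t|lborel. (1 / 2) * ?F y t)"
  proof (intro Bochner_Integration.integral_cong refl)
    fix y :: real
    have c: "complex_of_real (1 / (1 + y\<^sup>2)) = (1 / 2) * (LINT t|lborel. ?E t * cis (t * y))"
      by (subst fourier_exp_abs) simp
    have "cis (- (y * \<xi>)) * of_real (1 / (1 + y\<^sup>2)) * ?G y =
        (LINT t|lborel. (cis (- (y * \<xi>)) * ?G y * (1 / 2)) * (?E t * cis (t * y)))"
      by (subst c, subst integral_mult_right_zero) (simp add: mult_ac)
    also have "\<dots> = (LINT t|lborel. (1 / 2) * ?F y t)"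
      by (intro Bochner_Integration.integral_cong refl)
         (simp only: cis_split mult_ac)
    finally show "cis (- (y * \<xi>)) * of_real (1 / (1 + y\<^sup>2)) * ?G y = (LINT t|lborel. (1 / 2) * ?F y t)" .
  qed
  also have "\<dots> = (1 / 2) * (LINT y|lborel. LINT t|lborel. ?F y t)"
    by simp
  also have "(LINT y|lborel. LINT t|lborel. ?F y t) = (LINT t|lborel. LINT y|lborel. ?F y t)"
    by (rule lborel_pair.Fubini_integral[OF int, symmetric])
  also have "\<dots> = (LINT t|lborel. ?E t * (LINT y|lborel. cis (y * (t - \<xi>)) * ?G y))"
    by (subst integral_mult_right_zero[symmetric]) (simp add: mult_ac)
  also have "\<dots> = (LINT t|lborel. complex_of_real (exp (- \<bar>t\<bar>) * (sqrt (2 * pi) / \<sigma> * exp (- ((t - \<xi>) / \<sigma>)\<^sup>2 / 2))))"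
    by (subst integral_cis_gauss[OF assms]) simp
  also have "\<dots> = complex_of_real (LINT t|lborel. exp (- \<bar>t\<bar>) * (sqrt (2 * pi) / \<sigma> * exp (- ((t - \<xi>) / \<sigma>)\<^sup>2 / 2)))"
    by (rule integral_complex_of_real)
  also have "(LINT t|lborel. exp (- \<bar>t\<bar>) * (sqrt (2 * pi) / \<sigma> * exp (- ((t - \<xi>) / \<sigma>)\<^sup>2 / 2))) =
      \<sigma> * (LINT z|lborel. exp (- \<bar>\<xi> + \<sigma> * z\<bar>) * (sqrt (2 * pi) / \<sigma> * exp (- z\<^sup>2 / 2)))"
    using assms by (subst lborel_integral_real_affine[where c = \<sigma> and t = \<xi>]) auto
  also have "\<dots> = \<sigma> * (LINT z|lborel. (r * r / \<sigma>) * (exp (- \<bar>\<xi> + \<sigma> * z\<bar>) * std_normal_density z))"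
    using r(1) unfolding std_normal_density_def r_def[symmetric]
    by (intro arg_cong[where f = "\<lambda>x. \<sigma> * x"] Bochner_Integration.integral_cong refl) simp
  also have "\<dots> = 2 * pi * (LINT z|lborel. exp (- \<bar>\<xi> + \<sigma> * z\<bar>) * std_normal_density z)"
    unfolding r(2) using assms by (subst integral_mult_right_zero) simp
  finally show ?thesis by simp
qed

text \<open>As \<open>\<sigma>\<close> tends to 0, the Gaussian factor on the left tends to 1 and
  the Gaussian average on the right concentrates at \<open>\<xi>\<close>. The dominating functions
  are \<open>1 / (1 + y^2)\<close> and the normal density.\<close>

lemma fourier_cauchy:
  "(LINT y|lborel. cis (- (y * \<xi>)) * of_real (1 / (1 + y\<^sup>2))) = complex_of_real (pi * exp (- \<bar>\<xi>\<bar>))"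
proof -
  define \<sigma> where "\<sigma> n = 1 / real (Suc n)" for n
  have pos: "\<sigma> n > 0" for n by (simp add: \<sigma>_def)
  have \<sigma>: "\<sigma> \<longlonglongrightarrow> 0"
    unfolding \<sigma>_def using LIMSEQ_inverse_real_of_nat by (simp add: inverse_eq_divide)
  let ?S = "\<lambda>n. LINT y|lborel. cis (- (y * \<xi>)) * complex_of_real (1 / (1 + y\<^sup>2)) * of_real (exp (- (\<sigma> n * y)\<^sup>2 / 2))"
  have "?S \<longlonglongrightarrow> (LINT y|lborel. cis (- (y * \<xi>)) * complex_of_real (1 / (1 + y\<^sup>2)))"
  proof (rule integral_dominated_convergence[OF _ _ integrable_cauchy])
    have c: "continuous_on UNIV (\<lambda>r. cis (- (y * \<xi>)) * complex_of_real (1 / (1 + y\<^sup>2)) * of_real (exp (- (r * y)\<^sup>2 / 2)))" for y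
      by (intro continuous_intros) simp
    have "(\<lambda>n. cis (- (y * \<xi>)) * complex_of_real (1 / (1 + y\<^sup>2)) * of_real (exp (- (\<sigma> n * y)\<^sup>2 / 2)))
      \<longlonglongrightarrow> cis (- (y * \<xi>)) * complex_of_real (1 / (1 + y\<^sup>2)) * of_real (exp (- (0 * y)\<^sup>2 / 2))" for y
      by (rule continuous_on_tendsto_compose[OF c \<sigma>]) auto
    moreover have "of_real (exp (- (0 * y)\<^sup>2 / 2)) = (1 :: complex)" for y :: real
      by simp
    ultimately show "AE y in lborel. (\<lambda>n. cis (- (y * \<xi>)) * complex_of_real (1 / (1 + y\<^sup>2)) * of_real (exp (- (\<sigma> n * y)\<^sup>2 / 2)))
      \<longlonglongrightarrow> cis (- (y * \<xi>)) * complex_of_real (1 / (1 + y\<^sup>2))"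
      by (intro AE_I2) (simp only: mult_1_right)
    show "AE y in lborel. cmod (cis (- (y * \<xi>)) * complex_of_real (1 / (1 + y\<^sup>2)) * of_real (exp (- (\<sigma> n * y)\<^sup>2 / 2)))
        \<le> 1 / (1 + y\<^sup>2)" for n
    proof (rule AE_I2)
      fix y :: real
      have "(1 / (1 + y\<^sup>2)) * exp (- (\<sigma> n * y)\<^sup>2 / 2) \<le> (1 / (1 + y\<^sup>2)) * 1"
        by (intro mult_left_mono) auto
      then show "cmod (cis (- (y * \<xi>)) * complex_of_real (1 / (1 + y\<^sup>2)) * of_real (exp (- (\<sigma> n * y)\<^sup>2 / 2)))
          \<le> 1 / (1 + y\<^sup>2)"
        by (simp add: norm_mult del: of_real_divide)
    qed
  qed measurable
  moreover have "?S \<longlonglongrightarrow> complex_of_real (pi * (LINT z|lborel. exp (- \<bar>\<xi>\<bar>) * std_normal_density z))"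
    unfolding fourier_cauchy_regularised[OF pos]
  proof (intro tendsto_of_real tendsto_mult tendsto_const)
    show "(\<lambda>n. LINT z|lborel. exp (- \<bar>\<xi> + \<sigma> n * z\<bar>) * std_normal_density z) \<longlonglongrightarrow>
        (LINT z|lborel. exp (- \<bar>\<xi>\<bar>) * std_normal_density z)"
    proof (rule integral_dominated_convergence[where w = "std_normal_density"])
      have c: "continuous_on UNIV (\<lambda>r. exp (- \<bar>\<xi> + r * z\<bar>) * std_normal_density z)" for z
        by (intro continuous_intros)
      have "(\<lambda>n. exp (- \<bar>\<xi> + \<sigma> n * z\<bar>) * std_normal_density z) \<longlonglongrightarrow> exp (- \<bar>\<xi> + 0 * z\<bar>) * std_normal_density z" for z
        by (rule continuous_on_tendsto_compose[OF c \<sigma>]) auto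
      then show "AE z in lborel. (\<lambda>n. exp (- \<bar>\<xi> + \<sigma> n * z\<bar>) * std_normal_density z) \<longlonglongrightarrow> exp (- \<bar>\<xi>\<bar>) * std_normal_density z"
        by (intro AE_I2) (simp only: mult_zero_left add_0_right)
      have "norm (exp (- \<bar>\<xi> + \<sigma> n * z\<bar>) * std_normal_density z) \<le> std_normal_density z" for n z
        using mult_right_mono[of "exp (- \<bar>\<xi> + \<sigma> n * z\<bar>)" 1 "std_normal_density z"] by (simp add: abs_mult)
      then show "AE z in lborel. norm (exp (- \<bar>\<xi> + \<sigma> n * z\<bar>) * std_normal_density z) \<le> std_normal_density z" for n
        by simp
    qed auto
  qed
  ultimately have "(LINT y|lborel. cis (- (y * \<xi>)) * complex_of_real (1 / (1 + y\<^sup>2))) =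
      complex_of_real (pi * (LINT z|lborel. exp (- \<bar>\<xi>\<bar>) * std_normal_density z))"
    by (rule LIMSEQ_unique)
  then show ?thesis
    by simp
qed

lemma fourier_cauchy_scaled:
  assumes "\<delta> > 0"
  shows "(LINT y|lborel. cis (- (y * \<xi>)) * of_real (1 / (1 + (\<delta> * y)\<^sup>2))) =
     complex_of_real (pi / \<delta> * exp (- \<bar>\<xi>\<bar> / \<delta>))"
    and "integrable lborel (\<lambda>y. 1 / (1 + (\<delta> * y)\<^sup>2))"
proof -
  have "complex_of_real (pi * exp (- \<bar>\<xi> / \<delta>\<bar>)) = 
      (LINT y|lborel. cis (- (y * (\<xi> / \<delta>))) * of_real (1 / (1 + y\<^sup>2)))"
    by (rule fourier_cauchy[symmetric])
  also have "\<dots> = \<delta> *\<^sub>R (LINT y|lborel. cis (- (y * \<xi>)) * of_real (1 / (1 + (\<delta> * y)\<^sup>2)))"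
    using assms by (subst lborel_integral_real_affine[where c = \<delta> and t = 0]) auto
  finally show "(LINT y|lborel. cis (- (y * \<xi>)) * of_real (1 / (1 + (\<delta> * y)\<^sup>2))) =
     complex_of_real (pi / \<delta> * exp (- \<bar>\<xi>\<bar> / \<delta>))"
    using assms by (simp add: scaleR_conv_of_real field_simps)
  show "integrable lborel (\<lambda>y. 1 / (1 + (\<delta> * y)\<^sup>2))"
    using lborel_integrable_real_affine[OF integrable_cauchy, of \<delta> 0] assms by simp
qed

section \<open>Product kernels on Euclidean space\<close>

lemma
  fixes f :: "'a::euclidean_space \<Rightarrow> real \<Rightarrow> 'c::{real_normed_field, banach, second_countable_topology}"
  assumes f: "\<And>b. b \<in> Basis \<Longrightarrow> integrable lborel (f b)"
  shows integrable_lborel_prod: "integrable lborel (\<lambda>x. \<Prod>b\<in>Basis. f b (x \<bullet> b))"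
    and integral_lborel_prod:
      "(LINT x|lborel. (\<Prod>b\<in>Basis. f b (x \<bullet> b))) = (\<Prod>b\<in>Basis. LINT t|lborel. f b t)"
proof -
  interpret product_sigma_finite "\<lambda>_::'a. lborel :: real measure" ..
  have [measurable]: "f b \<in> borel_measurable borel" if "b \<in> Basis" for b
    using borel_measurable_integrable[OF f[OF that]] by simp
  have *: "(\<Prod>b\<in>Basis. f b ((\<Sum>c\<in>Basis. g c *\<^sub>R c) \<bullet> b)) = (\<Prod>b\<in>Basis. f b (g b))" for g
    by (intro prod.cong refl) simp
  show "integrable lborel (\<lambda>x. \<Prod>b\<in>Basis. f b (x \<bullet> b))"
    by (subst lborel_eq, subst integrable_distr_eq)
       (auto simp: * intro!: product_integrable_prod f)
  show "(LINT x|lborel. (\<Prod>b\<in>Basis. f b (x \<bullet> b))) = (\<Prod>b\<in>Basis. LINT t|lborel. f b t)"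
    by (subst lborel_eq, subst integral_distr)
       (auto simp: * intro!: product_integral_prod f)
qed

lemma cis_sum: "cis (\<Sum>i\<in>A. f i) = (\<Prod>i\<in>A. cis (f i))"
  by (induction A rule: infinite_finite_induct) (auto simp flip: cis_mult)

lemma cis_inner: "cis (x \<bullet> y) = (\<Prod>b\<in>Basis. cis ((x \<bullet> b) * (y \<bullet> b)))"
  for x y :: "'a::euclidean_space"
  by (simp add: euclidean_inner[of x y] cis_sum)

text \<open>The fundamental solution of the product over \<open>b\<close> of the operators
  \<open>1 + d/dx_b\<close>.\<close>

definition exp_kernel :: "'a::euclidean_space \<Rightarrow> real" where
  "exp_kernel x = (\<Prod>b\<in>Basis. exp_density (x \<bullet> b))"

text \<open>At \<open>\<delta> = 1\<close> this is the squared modulus of the transform of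
  \<open>exp_kernel\<close>. As \<open>\<delta>\<close> tends to 0 it tends to 1 pointwise, and so
  serves as an integrable cutoff.\<close>

definition cauchy_weight :: "real \<Rightarrow> 'a::euclidean_space \<Rightarrow> real" where
  "cauchy_weight \<delta> y = (\<Prod>b\<in>Basis. 1 / (1 + (\<delta> * (y \<bullet> b))\<^sup>2))"

lemma exp_density_bounds: "0 \<le> exp_density t" "exp_density t \<le> 1"
  by (auto simp: exp_density_eq indicator_def)

lemma exp_kernel_bounds: "0 \<le> exp_kernel x" "exp_kernel x \<le> 1"
  unfolding exp_kernel_def by (auto intro!: prod_nonneg prod_le_1 exp_density_bounds)

lemma cauchy_weight_bounds: "0 \<le> cauchy_weight \<delta> x" "cauchy_weight \<delta> x \<le> 1"
  unfolding cauchy_weight_def by (auto intro!: prod_nonneg prod_le_1 simp: divide_le_eq_1 add_pos_nonneg)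

lemma exp_kernel_measurable [measurable]: "exp_kernel \<in> borel_measurable borel"
  unfolding exp_kernel_def[abs_def] by measurable

lemma cauchy_weight_measurable [measurable]: "cauchy_weight \<delta> \<in> borel_measurable borel"
  unfolding cauchy_weight_def[abs_def] by measurable

lemma integrable_exp_kernel: "integrable lborel (exp_kernel :: 'a::euclidean_space \<Rightarrow> real)"
  and integral_exp_kernel: "(LINT x|lborel. exp_kernel (x::'a)) = 1"
  unfolding exp_kernel_def[abs_def]
  using integrable_lborel_prod[where f = "\<lambda>_::'a. exp_density"] 
    integral_lborel_prod[where f = "\<lambda>_::'a. exp_density"]
  by (auto simp: integrable_exp_density integral_exp_density)

lemma fourier_exp_kernel:
  fixes y :: "'a::euclidean_space"
  shows "(cmod (LINT t|lborel. complex_of_real (exp_kernel t) * cis (t \<bullet> y)))\<^sup>2 = cauchy_weight 1 y"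
proof -
  have int: "integrable lborel (\<lambda>t. complex_of_real (exp_density t) * cis (t * c))" for c
    by (rule Bochner_Integration.integrable_bound[OF integrable_exp_density])
       (auto simp: norm_mult)
  have "(LINT t|lborel. complex_of_real (exp_kernel t) * cis (t \<bullet> y)) =
      (LINT t|lborel. (\<Prod>b\<in>Basis. complex_of_real (exp_density (t \<bullet> b)) * cis ((t \<bullet> b) * (y \<bullet> b))))"
    by (simp add: exp_kernel_def cis_inner prod.distrib)
  also have "\<dots> = (\<Prod>b\<in>Basis. LINT t|lborel. complex_of_real (exp_density t) * cis (t * (y \<bullet> b)))"
    using integral_lborel_prod[where f = "\<lambda>b t. complex_of_real (exp_density t) * cis (t * (y \<bullet> b))", OF int]
    by simp
  also have "\<dots> = (\<Prod>b\<in>Basis. 1 / (1 - \<i> * (y \<bullet> b)))"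
    by (simp only: fourier_exp_density)
  finally have *: "(LINT t|lborel. complex_of_real (exp_kernel t) * cis (t \<bullet> y)) = (\<Prod>b\<in>Basis. 1 / (1 - \<i> * (y \<bullet> b)))" .
  have "(cmod (1 / (1 - \<i> * complex_of_real r)))\<^sup>2 = 1 / (1 + r\<^sup>2)" for r
    by (simp add: norm_divide power_divide cmod_power2)
  then show ?thesis
    unfolding * cauchy_weight_def by (simp only: prod_norm[symmetric] prod_power_distrib, simp)
qed

lemma autocorrelation_exp_density:
  "(LINT t|lborel. exp_density (x - t) * exp_density (y - t)) = exp (- \<bar>x - y\<bar>) / 2"
  "integrable lborel (\<lambda>t. exp_density (x - t) * exp_density (y - t))"
proof -
  \<comment> \<open>The product is supported on \<open>t \<le> min x y\<close>, where it equals
    \<open>exp (- (x + y - 2 * t))\<close>. Substituting \<open>t = min x y - s / 2\<close> turns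
    the exponent into \<open>- |x - y| - s\<close>; the Jacobian is the factor
    \<open>1 / 2\<close>.\<close>
  have eq: "exp_density (x - (min x y + (- 1 / 2) * s)) * exp_density (y - (min x y + (- 1 / 2) * s)) =
      exp (- \<bar>x - y\<bar>) * exp_density s" for s
    by (auto simp: exp_density_eq indicator_def min_def abs_if simp flip: exp_add)
  show "(LINT t|lborel. exp_density (x - t) * exp_density (y - t)) = exp (- \<bar>x - y\<bar>) / 2"
    by (subst lborel_integral_real_affine[where c = "- 1 / 2" and t = "min x y"])
       (simp_all only: eq, simp_all add: integral_exp_density)
  have "integrable lborel (\<lambda>s. exp_density (x - (min x y + (- 1 / 2) * s)) * exp_density (y - (min x y + (- 1 / 2) * s)))"
    unfolding eq by (intro integrable_mult_right integrable_exp_density)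
  then show "integrable lborel (\<lambda>t. exp_density (x - t) * exp_density (y - t))"
    by (rule iffD1[OF lborel_integrable_real_affine_iff, rotated]) simp
qed

lemma autocorrelation_exp_kernel:
  fixes \<xi> \<eta> :: "'a::euclidean_space"
  shows "(LINT t|lborel. exp_kernel (\<xi> - t) * exp_kernel (\<eta> - t)) = 
      (\<Prod>b\<in>Basis. exp (- \<bar>(\<xi> - \<eta>) \<bullet> b\<bar>) / 2)"
    and integrable_exp_kernel_mult: "integrable lborel (\<lambda>t. exp_kernel (\<xi> - t) * exp_kernel (\<eta> - t))"
proof -
  let ?f = "\<lambda>b t. exp_density (\<xi> \<bullet> b - t) * exp_density (\<eta> \<bullet> b - t)"
  have *: "exp_kernel (\<xi> - t) * exp_kernel (\<eta> - t) = (\<Prod>b\<in>Basis. ?f b (t \<bullet> b))" for t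
    by (simp add: exp_kernel_def inner_diff_left prod.distrib)
  show "(LINT t|lborel. exp_kernel (\<xi> - t) * exp_kernel (\<eta> - t)) = 
      (\<Prod>b\<in>Basis. exp (- \<bar>(\<xi> - \<eta>) \<bullet> b\<bar>) / 2)"
    unfolding * by (subst integral_lborel_prod) (simp_all only: autocorrelation_exp_density inner_diff_left)
  show "integrable lborel (\<lambda>t. exp_kernel (\<xi> - t) * exp_kernel (\<eta> - t))"
    unfolding * by (intro integrable_lborel_prod autocorrelation_exp_density)
qed

lemma integrable_cauchy_weight:
  assumes "\<delta> > 0"
  shows "integrable lborel (cauchy_weight \<delta> :: 'a::euclidean_space \<Rightarrow> real)"
  unfolding cauchy_weight_def[abs_def]
  using integrable_lborel_prod[where f = "\<lambda>_::'a. \<lambda>y. 1 / (1 + (\<delta> * y)\<^sup>2)"] fourier_cauchy_scaled(2)[OF assms]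
  by blast

lemma fourier_cauchy_weight:
  fixes \<xi> :: "'a::euclidean_space"
  assumes "\<delta> > 0"
  shows "(LINT y|lborel. complex_of_real (cauchy_weight \<delta> y) * cis (- (y \<bullet> \<xi>))) =
    of_real (\<Prod>b\<in>Basis. pi / \<delta> * exp (- \<bar>\<xi> \<bullet> b\<bar> / \<delta>))"
proof -
  let ?f = "\<lambda>b y. cis (- (y * (\<xi> \<bullet> b))) * complex_of_real (1 / (1 + (\<delta> * y)\<^sup>2))"
  have int: "integrable lborel (?f b)" for b
    by (rule Bochner_Integration.integrable_bound[OF fourier_cauchy_scaled(2)[OF assms]])
       (auto simp: norm_mult simp del: of_real_divide)
  have "cis (- (y \<bullet> \<xi>)) = (\<Prod>b\<in>Basis. cis (- ((y \<bullet> b) * (\<xi> \<bullet> b))))" for y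
    using cis_inner[of "- y" \<xi>] by simp
  then have "(LINT y|lborel. complex_of_real (cauchy_weight \<delta> y) * cis (- (y \<bullet> \<xi>))) =
      (LINT y|lborel. (\<Prod>b\<in>Basis. ?f b (y \<bullet> b)))"
    by (simp add: cauchy_weight_def prod.distrib mult.commute del: of_real_divide)
  also have "\<dots> = (\<Prod>b\<in>Basis. LINT y|lborel. ?f b y)"
    by (rule integral_lborel_prod[OF int])
  also have "\<dots> = of_real (\<Prod>b\<in>Basis. pi / \<delta> * exp (- \<bar>\<xi> \<bullet> b\<bar> / \<delta>))"
    by (simp only: fourier_cauchy_scaled(1)[OF assms] of_real_prod)
  finally show ?thesis .
qed

text \<open>Each coordinate factor is a rescaled \<open>exp (- |t|)\<close>, so its mass
  \<open>2 * pi\<close> does not depend on \<open>\<delta>\<close>. This uniformity gives the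
  constant in \<open>fourier_raw_square_le\<close>.\<close>

lemma poisson_kernel_integral:
  assumes "\<delta> > 0"
  shows "(LINT \<xi>|lborel. (\<Prod>b\<in>Basis. pi / \<delta> * exp (- \<bar>(\<xi>::'a::euclidean_space) \<bullet> b\<bar> / \<delta>))) = (2 * pi) ^ DIM('a)"
    and integrable_poisson_kernel:
      "integrable lborel (\<lambda>\<xi>::'a::euclidean_space. \<Prod>b\<in>Basis. pi / \<delta> * exp (- \<bar>\<xi> \<bullet> b\<bar> / \<delta>))"
proof -
  have "complex_of_real (LINT t|lborel. exp (- \<bar>t\<bar>)) = 2"
    using fourier_exp_abs[of 0] by simp
  then have "(LINT t|lborel. exp (- \<bar>t\<bar>)) = (2::real)"
    by (metis of_real_eq_iff of_real_numeral)
  moreover have "(LINT t|lborel. exp (- \<bar>t\<bar>)) = (1 / \<delta>) * (LINT t|lborel. exp (- \<bar>t\<bar> / \<delta>))"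
    using assms by (subst lborel_integral_real_affine[where c = "1 / \<delta>" and t = 0]) (auto simp: abs_mult)
  ultimately have 1: "(LINT t|lborel. pi / \<delta> * exp (- \<bar>t\<bar> / \<delta>)) = 2 * pi"
    using assms by (simp add: field_simps)
  have "integrable lborel (\<lambda>t. pi / \<delta> * exp (- \<bar>0 + (1 / \<delta>) * t\<bar>))"
    using assms by (intro integrable_mult_right lborel_integrable_real_affine integrable_exp_abs) auto
  then have 2: "integrable lborel (\<lambda>t. pi / \<delta> * exp (- \<bar>t\<bar> / \<delta>))"
    using assms by (simp add: abs_mult)
  show "(LINT \<xi>|lborel. (\<Prod>b\<in>Basis. pi / \<delta> * exp (- \<bar>(\<xi>::'a::euclidean_space) \<bullet> b\<bar> / \<delta>))) = (2 * pi) ^ DIM('a)"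
    by (subst integral_lborel_prod[where f = "\<lambda>_ t. pi / \<delta> * exp (- \<bar>t\<bar> / \<delta>)", OF 2]) (simp only: 1, simp)
  show "integrable lborel (\<lambda>\<xi>::'a::euclidean_space. \<Prod>b\<in>Basis. pi / \<delta> * exp (- \<bar>\<xi> \<bullet> b\<bar> / \<delta>))"
    by (intro integrable_lborel_prod 2)
qed

section \<open>Square integrals of integral operators\<close>

lemma integral_pair_mult:
  fixes f :: "'a \<Rightarrow> 'c::{real_normed_field, banach, second_countable_topology}"
  assumes M: "sigma_finite_measure M" and N: "sigma_finite_measure N" and f: "integrable M f" and g: "integrable N g"
  shows "(LINT p|(M \<Otimes>\<^sub>M N). f (fst p) * g (snd p)) = (LINT x|M. f x) * (LINT y|N. g y)"
proof -
  interpret pair_sigma_finite M N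
    using M N by (simp add: pair_sigma_finite_def)
  have "(LINT p|(M \<Otimes>\<^sub>M N). f (fst p) * g (snd p)) = (LINT x|M. LINT y|N. f x * g y)"
    using integral_fst'[OF integrable_pair_mult[OF M N f g]] by (simp add: case_prod_unfold)
  then show ?thesis by simp
qed

text \<open>The square expands into a double integral over a pair of frequencies, and the
  \<open>y\<close>-integral is taken first. Fubini is justified by the arithmetic-geometric mean
  inequality, which bounds the \<open>y\<close>-integral of
  \<open>|e y \<xi>| * |e y \<eta>|\<close> by \<open>B\<close> uniformly, leaving the integrable
  majorant \<open>B * |U \<xi>| * |U \<eta>|\<close>. It is applied to a weighted character and to a
  translated \<open>exp_kernel\<close>.\<close>

lemma square_integral_kernel:
  fixes e :: "'a::euclidean_space \<Rightarrow> 'a \<Rightarrow> complex"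
  assumes [measurable]: "case_prod e \<in> borel_measurable (borel \<Otimes>\<^sub>M borel)"
    and U: "integrable lborel U"
    and e_le: "\<And>y \<xi>. cmod (e y \<xi>) \<le> 1"
    and e_int: "\<And>\<xi>. integrable lborel (\<lambda>y. (cmod (e y \<xi>))\<^sup>2)"
    and e_B: "\<And>\<xi>. (LINT y|lborel. (cmod (e y \<xi>))\<^sup>2) \<le> B"
  shows "integrable lborel (\<lambda>y. (cmod (LINT \<xi>|lborel. U \<xi> * e y \<xi>))\<^sup>2)"
    and "complex_of_real (LINT y|lborel. (cmod (LINT \<xi>|lborel. U \<xi> * e y \<xi>))\<^sup>2) =
      (LINT p|(lborel \<Otimes>\<^sub>M lborel). U (fst p) * cnj (U (snd p)) * (LINT y|lborel. e y (fst p) * cnj (e y (snd p))))"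
proof -
  have Um [measurable]: "U \<in> borel_measurable borel"
    using borel_measurable_integrable[OF U] by simp
  have em [measurable (raw)]: "(\<lambda>x. e (f x) (g x)) \<in> borel_measurable N"
    if [measurable]: "f \<in> N \<rightarrow>\<^sub>M borel" "g \<in> N \<rightarrow>\<^sub>M borel" for f g and N :: "'n measure"
  proof -
    have "(\<lambda>x. case_prod e (f x, g x)) \<in> borel_measurable N"
      by measurable
    then show ?thesis by simp
  qed
  let ?P = "lborel \<Otimes>\<^sub>M lborel :: ('a \<times> 'a) measure"
  interpret PP: pair_sigma_finite ?P "lborel :: 'a measure"
    by (intro pair_sigma_finite.intro lborel_pair.sigma_finite_measure_axioms lborel.sigma_finite_measure_axioms)
  let ?G = "\<lambda>p y. (U (fst p) * e y (fst p)) * cnj (U (snd p) * e y (snd p))"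
  have amgm: "cmod (e y \<xi>) * cmod (e y \<eta>) \<le> ((cmod (e y \<xi>))\<^sup>2 + (cmod (e y \<eta>))\<^sup>2) / 2" for y \<xi> \<eta>
    using sum_squares_bound[of "cmod (e y \<xi>)" "cmod (e y \<eta>)"] by simp
  have ee: "integrable lborel (\<lambda>y. cmod (e y \<xi>) * cmod (e y \<eta>))" for \<xi> \<eta>
    by (rule Bochner_Integration.integrable_bound[where f = "\<lambda>y. ((cmod (e y \<xi>))\<^sup>2 + (cmod (e y \<eta>))\<^sup>2) / 2"])
       (use amgm e_int in \<open>auto simp: abs_mult\<close>)
  have ee_le: "(LINT y|lborel. cmod (e y \<xi>) * cmod (e y \<eta>)) \<le> B" for \<xi> \<eta>
  proof -
    have "(LINT y|lborel. cmod (e y \<xi>) * cmod (e y \<eta>)) \<le> (LINT y|lborel. ((cmod (e y \<xi>))\<^sup>2 + (cmod (e y \<eta>))\<^sup>2) / 2)"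
      by (intro integral_mono ee amgm) (use e_int in auto)
    also have "\<dots> \<le> B"
      using e_int e_B[of \<xi>] e_B[of \<eta>] by simp
    finally show ?thesis .
  qed
  have ee_nonneg: "0 \<le> (LINT y|lborel. cmod (e y \<xi>) * cmod (e y \<eta>))" for \<xi> \<eta>
    by (intro integral_nonneg_AE) auto
  have UU: "integrable ?P (\<lambda>p. U (fst p) * cnj (U (snd p)))"
    using integrable_pair_mult[OF lborel.sigma_finite_measure_axioms lborel.sigma_finite_measure_axioms U, of "\<lambda>x. cnj (U x)"] U
    by (simp add: case_prod_unfold)
  have int: "integrable (?P \<Otimes>\<^sub>M lborel) (\<lambda>(p, y). ?G p y)"
  proof (rule PP.Fubini_integrable)
    show "integrable ?P (\<lambda>p. LINT y|lborel. norm (case (p, y) of (p, y) \<Rightarrow> ?G p y))"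
    proof (rule Bochner_Integration.integrable_bound[OF integrable_mult_right[OF UU, of "of_real B"]])
      show "AE p in ?P. norm (LINT y|lborel. norm (case (p, y) of (p, y) \<Rightarrow> ?G p y)) \<le>
          norm (of_real B * (U (fst p) * cnj (U (snd p))))"
      proof (rule AE_I2)
        fix p :: "'a \<times> 'a"
        have "(LINT y|lborel. norm (?G p y)) =
            (LINT y|lborel. (cmod (U (fst p)) * cmod (U (snd p))) * (cmod (e y (fst p)) * cmod (e y (snd p))))"
          by (intro Bochner_Integration.integral_cong refl) (simp add: norm_mult mult_ac)
        also have "\<dots> = (cmod (U (fst p)) * cmod (U (snd p))) * (LINT y|lborel. cmod (e y (fst p)) * cmod (e y (snd p)))"
          by simp
        also have "norm \<dots> \<le> (cmod (U (fst p)) * cmod (U (snd p))) * \<bar>B\<bar>"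
          unfolding real_norm_def abs_mult
          by (intro mult_mono) (use ee_le[of "fst p" "snd p"] ee_nonneg[of "fst p" "snd p"] in auto)
        finally show "norm (LINT y|lborel. norm (case (p, y) of (p, y) \<Rightarrow> ?G p y)) \<le>
          norm (of_real B * (U (fst p) * cnj (U (snd p))))"
          by (simp add: norm_mult mult_ac)
      qed
    qed measurable
    show "AE p in ?P. integrable lborel (\<lambda>y. case (p, y) of (p, y) \<Rightarrow> ?G p y)"
    proof (rule AE_I2)
      fix p :: "'a \<times> 'a"
      show "integrable lborel (\<lambda>y. case (p, y) of (p, y) \<Rightarrow> ?G p y)"
        by (rule Bochner_Integration.integrable_bound[OF
              integrable_mult_right[OF ee[of "fst p" "snd p"], of "cmod (U (fst p)) * cmod (U (snd p))"]])
           (simp_all add: norm_mult abs_mult mult_ac)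
    qed
  qed measurable
  have inner: "(LINT p|?P. ?G p y) = of_real ((cmod (LINT \<xi>|lborel. U \<xi> * e y \<xi>))\<^sup>2)" for y
  proof -
    have Ue: "integrable lborel (\<lambda>\<xi>. U \<xi> * e y \<xi>)"
      by (rule Bochner_Integration.integrable_bound[OF U]) (use e_le in \<open>auto simp: norm_mult mult_left_le\<close>)
    have "(LINT p|?P. ?G p y) = (LINT \<xi>|lborel. U \<xi> * e y \<xi>) * (LINT \<xi>|lborel. cnj (U \<xi> * e y \<xi>))"
      by (intro integral_pair_mult lborel.sigma_finite_measure_axioms Ue) (use Ue in \<open>simp del: complex_cnj_mult\<close>)
    then show ?thesis
      unfolding complex_norm_square by (simp del: complex_cnj_mult)
  qed
  have "integrable lborel (\<lambda>y. LINT p|?P. ?G p y)"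
    using PP.integrable_snd[of "?G", OF int] .
  then have "integrable lborel (\<lambda>y. complex_of_real ((cmod (LINT \<xi>|lborel. U \<xi> * e y \<xi>))\<^sup>2))"
    unfolding inner .
  then show "integrable lborel (\<lambda>y. (cmod (LINT \<xi>|lborel. U \<xi> * e y \<xi>))\<^sup>2)"
    by (simp only: complex_of_real_integrable_eq)
  have "complex_of_real (LINT y|lborel. (cmod (LINT \<xi>|lborel. U \<xi> * e y \<xi>))\<^sup>2) = (LINT y|lborel. LINT p|?P. ?G p y)"
    unfolding inner by (rule integral_complex_of_real[symmetric])
  also have "\<dots> = (LINT p|?P. LINT y|lborel. ?G p y)"
    by (rule PP.Fubini_integral[OF int])
  also have "\<dots> = (LINT p|?P. LINT y|lborel. (U (fst p) * cnj (U (snd p))) * (e y (fst p) * cnj (e y (snd p))))"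
    by (intro Bochner_Integration.integral_cong refl) (simp add: mult_ac)
  finally show "complex_of_real (LINT y|lborel. (cmod (LINT \<xi>|lborel. U \<xi> * e y \<xi>))\<^sup>2) =
      (LINT p|?P. U (fst p) * cnj (U (snd p)) * (LINT y|lborel. e y (fst p) * cnj (e y (snd p))))"
    by simp
qed

lemma distr_lborel_reflect: "distr lborel borel (\<lambda>x. a - x) = (lborel :: 'a::euclidean_space measure)"
  using lborel_affine[of "-1" a] by (simp add: density_1)

lemma nn_integral_lborel_reflect:
  fixes a :: "'a::euclidean_space"
  assumes [measurable]: "f \<in> borel_measurable borel"
  shows "(\<integral>\<^sup>+x. f (a - x) \<partial>lborel) = (\<integral>\<^sup>+x. f x \<partial>lborel)"
  by (subst (2) distr_lborel_reflect[of a, symmetric]) (simp add: nn_integral_distr)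

lemma integral_lborel_reflect:
  fixes a :: "'a::euclidean_space" and f :: "'a \<Rightarrow> 'b::{banach, second_countable_topology}"
  assumes [measurable]: "f \<in> borel_measurable borel"
  shows "(LINT x|lborel. f (a - x)) = (LINT x|lborel. f x)"
  by (subst (2) distr_lborel_reflect[of a, symmetric]) (simp add: integral_distr)

lemma integrable_lborel_reflect:
  fixes a :: "'a::euclidean_space" and f :: "'a \<Rightarrow> 'b::{banach, second_countable_topology}"
  assumes "integrable lborel f"
  shows "integrable lborel (\<lambda>x. f (a - x))"
proof -
  have [measurable]: "f \<in> borel_measurable borel"
    using borel_measurable_integrable[OF assms] by simp
  have "integrable (distr lborel borel (\<lambda>x. a - x)) f"
    using assms by (simp add: distr_lborel_reflect)
  then show ?thesis
    by (simp add: integrable_distr_eq)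
qed

text \<open>Without the unitary constant, so that powers of \<open>2 * pi\<close> occur only in the
  few statements of Plancherel type.\<close>

definition fourier_raw :: "('a::euclidean_space \<Rightarrow> complex) \<Rightarrow> 'a \<Rightarrow> complex" where
  "fourier_raw U y = (LINT \<xi>|lborel. U \<xi> * cis (- (y \<bullet> \<xi>)))"

text \<open>The transpose of convolution with \<open>exp_kernel\<close>: it takes over a factor
  \<open>exp_kernel\<close> that is removed from the function \<open>U\<close> is integrated
  against.\<close>

definition exp_correlation :: "('a::euclidean_space \<Rightarrow> complex) \<Rightarrow> 'a \<Rightarrow> complex" where
  "exp_correlation U t = (LINT \<xi>|lborel. U \<xi> * complex_of_real (exp_kernel (\<xi> - t)))"

text \<open>The square root of the weight is attached to each of the two characters in
  \<open>square_integral_kernel\<close>. Their product then carries the full weight and depends only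
  on the difference of the frequencies, so its integral is the transform of the weight.\<close>

lemma weighted_fourier_raw:
  fixes U :: "'a::euclidean_space \<Rightarrow> complex"
  assumes U: "integrable lborel U" and "\<delta> > 0"
  shows "integrable lborel (\<lambda>y. cauchy_weight \<delta> y * (cmod (fourier_raw U y))\<^sup>2)"
    and "complex_of_real (LINT y|lborel. cauchy_weight \<delta> y * (cmod (fourier_raw U y))\<^sup>2) =
      (LINT p|(lborel \<Otimes>\<^sub>M lborel). U (fst p) * cnj (U (snd p)) *
         of_real (\<Prod>b\<in>Basis. pi / \<delta> * exp (- \<bar>(fst p - snd p) \<bullet> b\<bar> / \<delta>)))"
proof -
  let ?e = "\<lambda>y \<xi>::'a. complex_of_real (sqrt (cauchy_weight \<delta> y)) * cis (- (y \<bullet> \<xi>))"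
  have sq: "(cmod (?e y \<xi>))\<^sup>2 = cauchy_weight \<delta> y" for y \<xi>
    using cauchy_weight_bounds(1)[of \<delta> y] by (simp add: norm_mult power_mult_distrib)
  have le: "cmod (?e y \<xi>) \<le> 1" for y \<xi>
    using cauchy_weight_bounds[of \<delta> y] by (simp add: norm_mult)
  have meas: "case_prod ?e \<in> borel_measurable (borel \<Otimes>\<^sub>M borel)"
    by measurable
  have eU: "(cmod (LINT \<xi>|lborel. U \<xi> * ?e y \<xi>))\<^sup>2 = cauchy_weight \<delta> y * (cmod (fourier_raw U y))\<^sup>2" for y
  proof -
    have "(LINT \<xi>|lborel. U \<xi> * ?e y \<xi>) = complex_of_real (sqrt (cauchy_weight \<delta> y)) * fourier_raw U y"
      unfolding fourier_raw_def by (subst integral_mult_right_zero[symmetric]) (simp add: mult_ac)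
    then show ?thesis
      using cauchy_weight_bounds(1)[of \<delta> y] by (simp add: norm_mult power_mult_distrib)
  qed
  have ee: "?e y \<xi> * cnj (?e y \<eta>) = complex_of_real (cauchy_weight \<delta> y) * cis (- (y \<bullet> (\<xi> - \<eta>)))" for y \<xi> \<eta>
  proof -
    have "?e y \<xi> * cnj (?e y \<eta>) = of_real (sqrt (cauchy_weight \<delta> y) * sqrt (cauchy_weight \<delta> y)) *
        (cis (- (y \<bullet> \<xi>)) * cis (y \<bullet> \<eta>))"
      by (simp add: cis_cnj del: real_sqrt_mult_self)
    also have "cis (- (y \<bullet> \<xi>)) * cis (y \<bullet> \<eta>) = cis (- (y \<bullet> (\<xi> - \<eta>)))"
      by (simp add: cis_mult inner_diff_right)
    finally show ?thesis
      using cauchy_weight_bounds(1)[of \<delta> y] by simp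
  qed
  note kernel = square_integral_kernel[where e = ?e and U = U and B = "LINT y|lborel. cauchy_weight \<delta> (y :: 'a)",
      unfolded sq, OF meas U le integrable_cauchy_weight[OF \<open>\<delta> > 0\<close>] order_refl]
  show "integrable lborel (\<lambda>y. cauchy_weight \<delta> y * (cmod (fourier_raw U y))\<^sup>2)"
    using kernel(1) unfolding eU .
  show "complex_of_real (LINT y|lborel. cauchy_weight \<delta> y * (cmod (fourier_raw U y))\<^sup>2) =
      (LINT p|(lborel \<Otimes>\<^sub>M lborel). U (fst p) * cnj (U (snd p)) *
         of_real (\<Prod>b\<in>Basis. pi / \<delta> * exp (- \<bar>(fst p - snd p) \<bullet> b\<bar> / \<delta>)))"
    using kernel(2) unfolding eU ee fourier_cauchy_weight[OF \<open>\<delta> > 0\<close>] .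
qed

text \<open>Both sides are quadratic forms in \<open>U\<close>. Their kernels are the products over
  \<open>b\<close> of \<open>exp (- |t|) / 2\<close> and of \<open>pi * exp (- |t|)\<close>, where
  \<open>t\<close> is the coordinate of the frequency difference; the ratio per coordinate is
  \<open>1 / (2 * pi)\<close>.\<close>

lemma exp_correlation_square:
  fixes U :: "'a::euclidean_space \<Rightarrow> complex"
  assumes U: "integrable lborel U"
  shows "integrable lborel (\<lambda>t. (cmod (exp_correlation U t))\<^sup>2)"
    and "(LINT t|lborel. (cmod (exp_correlation U t))\<^sup>2) =
      (1 / (2 * pi) ^ DIM('a)) * (LINT y|lborel. cauchy_weight 1 y * (cmod (fourier_raw U y))\<^sup>2)"
proof -
  let ?e = "\<lambda>t \<xi>::'a. complex_of_real (exp_kernel (\<xi> - t))"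
  have sq: "(cmod (?e t \<xi>))\<^sup>2 = exp_kernel (\<xi> - t) * exp_kernel (\<xi> - t)" for t \<xi>
    by (simp add: power2_eq_square)
  have le: "cmod (?e t \<xi>) \<le> 1" for t \<xi>
    using exp_kernel_bounds[of "\<xi> - t"] by simp
  have meas: "case_prod ?e \<in> borel_measurable (borel \<Otimes>\<^sub>M borel)"
    by measurable
  have B: "(LINT t|lborel. exp_kernel (\<xi> - t) * exp_kernel (\<xi> - t)) \<le> (1 / 2) ^ DIM('a)" for \<xi> :: 'a
    by (simp add: autocorrelation_exp_kernel)
  \<comment> \<open>The redundant divisions by 1 match \<open>weighted_fourier_raw\<close> at
    \<open>\<delta> = 1\<close> literally.\<close>
  have ee: "(LINT t|lborel. ?e t \<xi> * cnj (?e t \<eta>)) = 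
      of_real (1 / (2 * pi) ^ DIM('a)) * of_real (\<Prod>b\<in>Basis. pi / 1 * exp (- \<bar>(\<xi> - \<eta>) \<bullet> b\<bar> / 1))" for \<xi> \<eta> :: 'a
  proof -
    have "(LINT t|lborel. ?e t \<xi> * cnj (?e t \<eta>)) = of_real (LINT t|lborel. exp_kernel (\<xi> - t) * exp_kernel (\<eta> - t))"
      by (subst integral_complex_of_real[symmetric]) simp
    also have "(LINT t|lborel. exp_kernel (\<xi> - t) * exp_kernel (\<eta> - t)) =
        (\<Prod>b\<in>Basis. (1 / (2 * pi)) * (pi / 1 * exp (- \<bar>(\<xi> - \<eta>) \<bullet> b\<bar> / 1)))"
      unfolding autocorrelation_exp_kernel by simp
    also have "\<dots> = (1 / (2 * pi) ^ DIM('a)) * (\<Prod>b\<in>Basis. pi / 1 * exp (- \<bar>(\<xi> - \<eta>) \<bullet> b\<bar> / 1))"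
      by (subst prod.distrib) (simp add: power_one_over)
    finally show ?thesis by (simp only: of_real_mult)
  qed
  note kernel = square_integral_kernel[where e = ?e and U = U and B = "(1 / 2) ^ DIM('a)",
      unfolded sq, OF meas U le integrable_exp_kernel_mult B, folded exp_correlation_def]
  show "integrable lborel (\<lambda>t. (cmod (exp_correlation U t))\<^sup>2)"
    by (rule kernel(1))
  have "complex_of_real (LINT t|lborel. (cmod (exp_correlation U t))\<^sup>2) =
      (LINT p|(lborel \<Otimes>\<^sub>M lborel). of_real (1 / (2 * pi) ^ DIM('a)) * (U (fst p) * cnj (U (snd p)) *
         of_real (\<Prod>b\<in>Basis. pi / 1 * exp (- \<bar>(fst p - snd p) \<bullet> b\<bar> / 1))))"
    unfolding kernel(2) ee by (intro Bochner_Integration.integral_cong refl) (simp only: mult_ac)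
  also have "\<dots> = of_real (1 / (2 * pi) ^ DIM('a)) *
      of_real (LINT y|lborel. cauchy_weight 1 y * (cmod (fourier_raw U y))\<^sup>2)"
    by (subst weighted_fourier_raw(2)[OF U zero_less_one]) (rule integral_mult_right_zero)
  finally show "(LINT t|lborel. (cmod (exp_correlation U t))\<^sup>2) =
      (1 / (2 * pi) ^ DIM('a)) * (LINT y|lborel. cauchy_weight 1 y * (cmod (fourier_raw U y))\<^sup>2)"
    by (simp only: of_real_mult[symmetric] of_real_eq_iff)
qed

lemma fourier_raw_measurable [measurable]:
  fixes U :: "'a::euclidean_space \<Rightarrow> complex"
  assumes [measurable]: "U \<in> borel_measurable borel"
  shows "fourier_raw U \<in> borel_measurable borel"
  unfolding fourier_raw_def[abs_def] by measurable

lemma exp_correlation_measurable [measurable]: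
  fixes U :: "'a::euclidean_space \<Rightarrow> complex"
  assumes [measurable]: "U \<in> borel_measurable borel"
  shows "exp_correlation U \<in> borel_measurable borel"
  unfolding exp_correlation_def[abs_def] by measurable

text \<open>Fubini, with \<open>U\<close> and \<open>exp_kernel\<close> integrable and
  \<open>h\<close> bounded. For \<open>h\<close> a translated test function this moves a factor
  \<open>exp_kernel\<close> onto \<open>U\<close>; for \<open>h\<close> a character it is the
  convolution theorem; for \<open>h = 1\<close> it gives integrability of the correlation.\<close>

lemma
  fixes U :: "'a::euclidean_space \<Rightarrow> complex"
  assumes U: "integrable lborel U" and h [measurable]: "h \<in> borel_measurable borel" and h_le: "\<And>t. cmod (h t) \<le> B"
  shows integral_mult_exp_correlation:
      "(LINT t|lborel. h t * exp_correlation U t) = (LINT \<xi>|lborel. U \<xi> * (LINT t|lborel. h (\<xi> - t) * of_real (exp_kernel t)))"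
    and integrable_mult_exp_correlation: "integrable lborel (\<lambda>t. h t * exp_correlation U t)"
proof -
  have [measurable]: "U \<in> borel_measurable borel"
    using borel_measurable_integrable[OF U] by simp
  let ?F = "\<lambda>\<xi> t. h t * (U \<xi> * complex_of_real (exp_kernel (\<xi> - t)))"
  have B: "0 \<le> B" using norm_ge_zero[of "h 0"] h_le[of 0] by linarith
  have ek: "integrable lborel (\<lambda>t. exp_kernel (\<xi> - t))" "(LINT t|lborel. exp_kernel (\<xi> - t)) = 1" for \<xi> :: 'a
    by (simp_all add: integrable_lborel_reflect integrable_exp_kernel integral_lborel_reflect integral_exp_kernel)
  have F_le: "cmod (?F \<xi> t) \<le> B * cmod (U \<xi>) * exp_kernel (\<xi> - t)" for \<xi> t
    using mult_right_mono[OF h_le[of t], of "cmod (U \<xi>) * exp_kernel (\<xi> - t)"] exp_kernel_bounds[of "\<xi> - t"]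
    by (simp add: norm_mult mult_ac)
  have F_int: "integrable lborel (\<lambda>t. ?F \<xi> t)" for \<xi>
  proof (rule Bochner_Integration.integrable_bound[OF integrable_mult_right[OF ek(1)[of \<xi>], of "B * cmod (U \<xi>)"]])
    show "AE t in lborel. norm (?F \<xi> t) \<le> norm (B * cmod (U \<xi>) * exp_kernel (\<xi> - t))"
    proof (rule AE_I2)
      fix t
      show "norm (?F \<xi> t) \<le> norm (B * cmod (U \<xi>) * exp_kernel (\<xi> - t))"
        unfolding real_norm_def by (rule order_trans[OF F_le abs_ge_self])
    qed
  qed measurable
  have int: "integrable (lborel \<Otimes>\<^sub>M lborel) (case_prod ?F)"
  proof (rule lborel_pair.Fubini_integrable)
    show "integrable lborel (\<lambda>\<xi>. LINT t|lborel. norm (case (\<xi>, t) of (\<xi>, t) \<Rightarrow> ?F \<xi> t))"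
    proof (rule Bochner_Integration.integrable_bound[OF integrable_mult_right[OF U, of "of_real B"]])
      show "AE \<xi> in lborel. norm (LINT t|lborel. norm (case (\<xi>, t) of (\<xi>, t) \<Rightarrow> ?F \<xi> t)) \<le> norm (of_real B * U \<xi>)"
      proof (rule AE_I2)
        fix \<xi> :: 'a
        have "(LINT t|lborel. norm (?F \<xi> t)) \<le> (LINT t|lborel. B * cmod (U \<xi>) * exp_kernel (\<xi> - t))"
          by (intro integral_mono F_le integrable_norm F_int integrable_mult_right ek(1))
        then show "norm (LINT t|lborel. norm (case (\<xi>, t) of (\<xi>, t) \<Rightarrow> ?F \<xi> t)) \<le> norm (of_real B * U \<xi>)"
          using B ek(2)[of \<xi>] by (simp add: norm_mult integral_nonneg_AE)
      qed
    qed measurable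
  qed (use F_int in \<open>measurable, auto\<close>)
  have eq: "(LINT \<xi>|lborel. ?F \<xi> t) = h t * exp_correlation U t" for t
    unfolding exp_correlation_def by simp
  show "integrable lborel (\<lambda>t. h t * exp_correlation U t)"
    using lborel_pair.integrable_snd[OF int] unfolding eq .
  have "(LINT t|lborel. h t * exp_correlation U t) = (LINT t|lborel. LINT \<xi>|lborel. ?F \<xi> t)"
    unfolding eq ..
  also have "\<dots> = (LINT \<xi>|lborel. LINT t|lborel. ?F \<xi> t)"
    by (rule lborel_pair.Fubini_integral[OF int])
  also have "\<dots> = (LINT \<xi>|lborel. U \<xi> * (LINT t|lborel. h t * of_real (exp_kernel (\<xi> - t))))"
    by (subst integral_mult_right_zero[symmetric]) (simp add: mult_ac)
  also have "\<dots> = (LINT \<xi>|lborel. U \<xi> * (LINT t|lborel. h (\<xi> - t) * of_real (exp_kernel t)))"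
  proof (rule Bochner_Integration.integral_cong[OF refl])
    fix \<xi> :: 'a
    have "(LINT t|lborel. h t * of_real (exp_kernel (\<xi> - t))) = (LINT t|lborel. h (\<xi> - t) * of_real (exp_kernel t))"
      using integral_lborel_reflect[of "\<lambda>t. h t * of_real (exp_kernel (\<xi> - t))" \<xi>] by simp
    then show "U \<xi> * (LINT t|lborel. h t * of_real (exp_kernel (\<xi> - t))) =
        U \<xi> * (LINT t|lborel. h (\<xi> - t) * of_real (exp_kernel t))"
      by simp
  qed
  finally show "(LINT t|lborel. h t * exp_correlation U t) =
      (LINT \<xi>|lborel. U \<xi> * (LINT t|lborel. h (\<xi> - t) * of_real (exp_kernel t)))" .
qed

lemma integrable_exp_correlation:
  fixes U :: "'a::euclidean_space \<Rightarrow> complex"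
  assumes "integrable lborel U"
  shows "integrable lborel (exp_correlation U)"
  using integrable_mult_exp_correlation[OF assms, of "\<lambda>_. 1" 1] by simp

text \<open>Correlation multiplies the transform by \<open>?c\<close>, the transform of
  \<open>exp_kernel\<close> at \<open>- y\<close>. Only its modulus matters, and each correlation
  thus gains one factor of the weight.\<close>

lemma fourier_raw_exp_correlation:
  fixes U :: "'a::euclidean_space \<Rightarrow> complex"
  assumes U: "integrable lborel U"
  shows "(cmod (fourier_raw (exp_correlation U) y))\<^sup>2 = cauchy_weight 1 y * (cmod (fourier_raw U y))\<^sup>2"
proof -
  let ?c = "LINT t|lborel. complex_of_real (exp_kernel t) * cis (t \<bullet> y)"
  have "fourier_raw (exp_correlation U) y = (LINT t|lborel. cis (- (y \<bullet> t)) * exp_correlation U t)"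
    unfolding fourier_raw_def by (simp add: mult.commute)
  also have "\<dots> = (LINT \<xi>|lborel. U \<xi> * (LINT t|lborel. cis (- (y \<bullet> (\<xi> - t))) * of_real (exp_kernel t)))"
    by (rule integral_mult_exp_correlation[OF U, of _ 1]) auto
  also have "\<dots> = (LINT \<xi>|lborel. U \<xi> * cis (- (y \<bullet> \<xi>)) * ?c)"
  proof (rule Bochner_Integration.integral_cong[OF refl])
    fix \<xi> :: 'a
    have "cis (- (y \<bullet> (\<xi> - t))) = cis (- (y \<bullet> \<xi>)) * cis (t \<bullet> y)" for t
      by (simp add: cis_mult inner_diff_right inner_commute)
    then have "(LINT t|lborel. cis (- (y \<bullet> (\<xi> - t))) * of_real (exp_kernel t)) = cis (- (y \<bullet> \<xi>)) * ?c"
      by (subst integral_mult_right_zero[symmetric]) (simp add: mult_ac)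
    then show "U \<xi> * (LINT t|lborel. cis (- (y \<bullet> (\<xi> - t))) * of_real (exp_kernel t)) = U \<xi> * cis (- (y \<bullet> \<xi>)) * ?c"
      by simp
  qed
  also have "\<dots> = fourier_raw U y * ?c"
    unfolding fourier_raw_def by simp
  finally show ?thesis
    by (simp add: norm_mult power_mult_distrib fourier_exp_kernel mult.commute)
qed

text \<open>Schur's test: \<open>|U x| * |U y|\<close> is at most the mean of the two squares, and
  by symmetry of \<open>K\<close> both squares contribute equally. Working in \<open>ennreal\<close>
  avoids any assumption that the right side is finite.\<close>

lemma nn_integral_convolution_square:
  fixes U :: "'a::euclidean_space \<Rightarrow> complex" and K :: "'a \<Rightarrow> real"
  assumes [measurable]: "U \<in> borel_measurable borel" "K \<in> borel_measurable borel"
    and sym: "\<And>x. K (- x) = K x" and nn: "\<And>x. 0 \<le> K x"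
  shows "(\<integral>\<^sup>+p. ennreal (cmod (U (fst p) * cnj (U (snd p)) * of_real (K (fst p - snd p)))) \<partial>(lborel \<Otimes>\<^sub>M lborel))
    \<le> (\<integral>\<^sup>+x. ennreal (K x) \<partial>lborel) * (\<integral>\<^sup>+x. ennreal ((cmod (U x))\<^sup>2) \<partial>lborel)"
proof -
  let ?U = "\<lambda>x. ennreal ((cmod (U x))\<^sup>2)"
  let ?A = "\<integral>\<^sup>+x. \<integral>\<^sup>+y. ?U x * ennreal (K (x - y)) \<partial>lborel \<partial>lborel"
  have "ennreal (cmod (U x * cnj (U y) * of_real (K (x - y)))) \<le>
      ennreal (1/2) * (?U x * ennreal (K (x - y)) + ?U y * ennreal (K (x - y)))" for x y
  proof -
    have "cmod (U x) * cmod (U y) * K (x - y) \<le> ((cmod (U x))\<^sup>2 + (cmod (U y))\<^sup>2) / 2 * K (x - y)"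
      using sum_squares_bound[of "cmod (U x)" "cmod (U y)"] nn by (intro mult_right_mono) auto
    then have "ennreal (cmod (U x * cnj (U y) * of_real (K (x - y)))) \<le>
        ennreal (1/2 * ((cmod (U x))\<^sup>2 * K (x - y) + (cmod (U y))\<^sup>2 * K (x - y)))"
      using nn[of "x - y"] by (intro ennreal_leI) (simp add: norm_mult field_simps)
    also have "\<dots> = ennreal (1/2) * (?U x * ennreal (K (x - y)) + ?U y * ennreal (K (x - y)))"
      using nn[of "x - y"] by (subst ennreal_mult, simp, simp, subst ennreal_plus) (simp_all add: ennreal_mult)
    finally show ?thesis .
  qed
  then have "(\<integral>\<^sup>+p. ennreal (cmod (U (fst p) * cnj (U (snd p)) * of_real (K (fst p - snd p)))) \<partial>(lborel \<Otimes>\<^sub>M lborel)) \<le>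
      (\<integral>\<^sup>+x. \<integral>\<^sup>+y. ennreal (1/2) * (?U x * ennreal (K (x - y)) + ?U y * ennreal (K (x - y))) \<partial>lborel \<partial>lborel)"
    by (subst lborel.nn_integral_fst[symmetric]) (measurable, auto intro!: nn_integral_mono)
  also have "\<dots> = ennreal (1/2) * (?A + (\<integral>\<^sup>+x. \<integral>\<^sup>+y. ?U y * ennreal (K (x - y)) \<partial>lborel \<partial>lborel))"
    by (simp add: nn_integral_cmult nn_integral_add)
  also have "(\<integral>\<^sup>+x. \<integral>\<^sup>+y. ?U y * ennreal (K (x - y)) \<partial>lborel \<partial>lborel) =
      (\<integral>\<^sup>+y. \<integral>\<^sup>+x. ?U y * ennreal (K (x - y)) \<partial>lborel \<partial>lborel)"
    by (rule lborel_pair.Fubini'[symmetric]) simp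
  also have "\<dots> = ?A"
    by (intro nn_integral_cong) (metis sym minus_diff_eq)
  also have "?A = (\<integral>\<^sup>+x. ennreal (K x) \<partial>lborel) * (\<integral>\<^sup>+x. ?U x \<partial>lborel)"
    by (simp add: nn_integral_cmult nn_integral_multc nn_integral_lborel_reflect[of "\<lambda>x. ennreal (K x)"] mult.commute)
  also have "ennreal (1/2) * (\<dots> + \<dots>) = \<dots>"
  proof -
    have "ennreal (1/2) * ennreal 2 = 1"
      by (subst ennreal_mult[symmetric]) auto
    then show ?thesis
      by (simp only: mult_2[symmetric] mult.assoc[symmetric] ennreal_numeral mult_1_left)
  qed
  finally show ?thesis .
qed

text \<open>Inserting \<open>cauchy_weight (\<delta> n)\<close> makes the left side a quadratic form
  in \<open>U\<close> whose kernel has mass \<open>(2 * pi) ^ DIM('a)\<close> for every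
  \<open>n\<close>. Schur's test bounds it uniformly, and Fatou's lemma removes the weight.\<close>

lemma fourier_raw_square_le:
  fixes U :: "'a::euclidean_space \<Rightarrow> complex"
  assumes U: "integrable lborel U"
  shows "(\<integral>\<^sup>+y. ennreal ((cmod (fourier_raw U y))\<^sup>2) \<partial>lborel) \<le>
    ennreal ((2 * pi) ^ DIM('a)) * (\<integral>\<^sup>+x. ennreal ((cmod (U x))\<^sup>2) \<partial>lborel)"
proof -
  have [measurable]: "U \<in> borel_measurable borel"
    using borel_measurable_integrable[OF U] by simp
  let ?I = "\<integral>\<^sup>+x. ennreal ((cmod (U x))\<^sup>2) \<partial>lborel"
  define \<delta> where "\<delta> n = 1 / real (Suc n)" for n
  have \<delta>: "\<delta> n > 0" for n by (simp add: \<delta>_def)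
  have lim: "\<delta> \<longlonglongrightarrow> 0"
    unfolding \<delta>_def using LIMSEQ_inverse_real_of_nat by (simp add: inverse_eq_divide)
  have bound: "(\<integral>\<^sup>+y. ennreal (cauchy_weight (\<delta> n) y * (cmod (fourier_raw U y))\<^sup>2) \<partial>lborel) \<le> ennreal ((2 * pi) ^ DIM('a)) * ?I" for n
  proof -
    define K :: "'a \<Rightarrow> real" where "K = (\<lambda>x. \<Prod>b\<in>Basis. pi / \<delta> n * exp (- \<bar>x \<bullet> b\<bar> / \<delta> n))"
    have [measurable]: "K \<in> borel_measurable borel"
      unfolding K_def by measurable
    have K: "0 \<le> K x" "K (- x) = K x" for x
      using \<delta>[of n] by (auto simp: K_def intro!: prod_nonneg)
    have KI: "(\<integral>\<^sup>+x. ennreal (K x) \<partial>lborel) = ennreal ((2 * pi) ^ DIM('a))"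
      using nn_integral_eq_integral[OF integrable_poisson_kernel[OF \<delta>[of n], where 'a = 'a]]
        poisson_kernel_integral[OF \<delta>[of n], where 'a = 'a] K(1) by (simp add: K_def)
    let ?G = "\<lambda>p. U (fst p) * cnj (U (snd p)) * complex_of_real (K (fst p - snd p))"
    let ?J = "LINT y|lborel. cauchy_weight (\<delta> n) y * (cmod (fourier_raw U y))\<^sup>2"
    have J: "0 \<le> ?J"
      by (intro integral_nonneg_AE) (auto intro!: mult_nonneg_nonneg cauchy_weight_bounds)
    have "(\<integral>\<^sup>+y. ennreal (cauchy_weight (\<delta> n) y * (cmod (fourier_raw U y))\<^sup>2) \<partial>lborel) = ennreal ?J"
      by (rule nn_integral_eq_integral[OF weighted_fourier_raw(1)[OF U \<delta>]])
         (auto intro!: mult_nonneg_nonneg cauchy_weight_bounds)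
    also have "?J = cmod (LINT p|(lborel \<Otimes>\<^sub>M lborel). ?G p)"
      using J unfolding K_def weighted_fourier_raw(2)[OF U \<delta>, symmetric] by (simp del: of_real_mult)
    also have "ennreal \<dots> \<le> (\<integral>\<^sup>+p. ennreal (cmod (?G p)) \<partial>(lborel \<Otimes>\<^sub>M lborel))"
    \<comment> \<open>Without integrability the integral is 0 by convention and the bound is
      trivial.\<close>
    proof (cases "integrable (lborel \<Otimes>\<^sub>M lborel) ?G")
      case True
      then show ?thesis by (rule integral_norm_bound_ennreal)
    qed (simp add: not_integrable_integral_eq)
    also have "\<dots> \<le> (\<integral>\<^sup>+x. ennreal (K x) \<partial>lborel) * ?I"
      by (rule nn_integral_convolution_square) (simp_all add: K)
    finally show ?thesis unfolding KI .
  qed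
  have conv: "(\<lambda>n. cauchy_weight (\<delta> n) y * (cmod (fourier_raw U y))\<^sup>2) \<longlonglongrightarrow> (cmod (fourier_raw U y))\<^sup>2" for y :: 'a
  proof -
    have "continuous_on UNIV (\<lambda>r. cauchy_weight r y * (cmod (fourier_raw U y))\<^sup>2)"
      unfolding cauchy_weight_def by (intro continuous_intros) (auto simp: add_nonneg_eq_0_iff)
    then have "(\<lambda>n. cauchy_weight (\<delta> n) y * (cmod (fourier_raw U y))\<^sup>2) \<longlonglongrightarrow> cauchy_weight 0 y * (cmod (fourier_raw U y))\<^sup>2"
      by (rule continuous_on_tendsto_compose[OF _ lim]) auto
    moreover have "cauchy_weight 0 y = 1"
      by (simp add: cauchy_weight_def)
    ultimately show ?thesis by simp
  qed
  have "(\<integral>\<^sup>+y. ennreal ((cmod (fourier_raw U y))\<^sup>2) \<partial>lborel) =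
      (\<integral>\<^sup>+y. liminf (\<lambda>n. ennreal (cauchy_weight (\<delta> n) y * (cmod (fourier_raw U y))\<^sup>2)) \<partial>lborel)"
    by (intro nn_integral_cong lim_imp_Liminf[symmetric] tendsto_ennrealI conv) simp
  also have "\<dots> \<le> liminf (\<lambda>n. \<integral>\<^sup>+y. ennreal (cauchy_weight (\<delta> n) y * (cmod (fourier_raw U y))\<^sup>2) \<partial>lborel)"
    by (rule nn_integral_liminf) simp
  also have "\<dots> \<le> ennreal ((2 * pi) ^ DIM('a)) * ?I"
    using Liminf_mono[OF always_eventually[OF allI[OF bound]], of sequentially] by (simp add: Liminf_const)
  finally show ?thesis .
qed

section \<open>Test functions as convolutions with the exponential kernel\<close>

definition test_function :: "('a::euclidean_space \<Rightarrow> real) \<Rightarrow> bool" where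
  "test_function f \<longleftrightarrow> smooth f \<and> (\<exists>r. \<forall>x. r < norm x \<longrightarrow> f x = 0)"

lemma higher_differentiable_add:
  "higher_differentiable n f \<Longrightarrow> higher_differentiable n g \<Longrightarrow> higher_differentiable n (\<lambda>x. f x + g x)"
proof (induction n arbitrary: f g)
  case 0
  then show ?case by (auto intro: continuous_on_add)
next
  case (Suc n)
  have d: "f differentiable (at x)" "g differentiable (at x)" for x
    using Suc.prems by auto
  have "frechet_derivative (\<lambda>x. f x + g x) (at x) v =
      frechet_derivative f (at x) v + frechet_derivative g (at x) v" for x v
    using frechet_derivative_at[OF has_derivative_add[OF d(1)[unfolded frechet_derivative_works] d(2)[unfolded frechet_derivative_works]]]
    by (metis (no_types))
  then show ?case
    using Suc d by auto
qed

lemma smooth_add: "smooth f \<Longrightarrow> smooth g \<Longrightarrow> smooth (\<lambda>x. f x + g x)"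
  unfolding smooth_def by (blast intro: higher_differentiable_add)

lemma smooth_frechet_derivative: "smooth f \<Longrightarrow> smooth (\<lambda>x. frechet_derivative f (at x) v)"
  unfolding smooth_def by (metis higher_differentiable.simps(2))

lemma smooth_continuous: "smooth f \<Longrightarrow> continuous_on UNIV f"
  unfolding smooth_def by (metis higher_differentiable.simps(1))

lemma smooth_has_derivative: "smooth f \<Longrightarrow> (f has_derivative frechet_derivative f (at x)) (at x)"
  unfolding smooth_def by (metis higher_differentiable.simps(2) frechet_derivative_works)

text \<open>This is the operator that the one-sided exponential inverts; the class has to be stable
  under it for the inversion to be repeated. Outside the ball \<open>f\<close> vanishes on an open
  set, so its derivative vanishes there too.\<close>

lemma test_function_add_derivative:
  assumes "test_function f"
  shows "test_function (\<lambda>x. f x + frechet_derivative f (at x) v)"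
proof -
  from assms obtain r where f: "smooth f" and r: "\<And>x. r < norm x \<Longrightarrow> f x = 0"
    by (auto simp: test_function_def)
  have "frechet_derivative f (at x) v = 0" if "r < norm x" for x
  proof -
    have "open {x. r < norm x}"
      by (intro open_Collect_less continuous_intros)
    then have "(f has_derivative (\<lambda>_. 0)) (at x)"
      by (rule has_derivative_transform_within_open[OF has_derivative_const[of 0]]) (use that r in auto)
    then show ?thesis
      by (metis frechet_derivative_at)
  qed
  then show ?thesis
    using f r by (auto simp: test_function_def intro!: smooth_add smooth_frechet_derivative exI[of _ r])
qed

lemma continuous_bounded_support_bounded:
  fixes h :: "'a::euclidean_space \<Rightarrow> real"
  assumes "continuous_on UNIV h" and r: "\<And>x. r < norm x \<Longrightarrow> h x = 0"
  obtains C where "C > 0" "\<And>x. \<bar>h x\<bar> \<le> C"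
proof -
  have "bounded (h ` cball 0 r)"
    by (rule compact_imp_bounded[OF compact_continuous_image[OF continuous_on_subset[OF assms(1)]]]) auto
  then obtain C where "C > 0" and C: "\<And>x. x \<in> cball 0 r \<Longrightarrow> norm (h x) \<le> C"
    by (auto simp: bounded_pos)
  have "\<bar>h x\<bar> \<le> C" for x
  proof (cases "norm x \<le> r")
    case False
    then show ?thesis using r[of x] \<open>C > 0\<close> by simp
  qed (use C in auto)
  with \<open>C > 0\<close> show thesis by (rule that)
qed

text \<open>The quotient by the strictly positive weight is continuous with bounded support. A
  majorant in product form makes sums over lattice translates factor into one-dimensional
  sums.\<close>

lemma test_function_bound:
  assumes "test_function (f :: 'a::euclidean_space \<Rightarrow> real)"
  obtains C where "C > 0" "\<And>x. \<bar>f x\<bar> \<le> C * cauchy_weight 1 x"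
proof -
  from assms obtain r where f: "smooth f" and r: "\<And>x. r < norm x \<Longrightarrow> f x = 0"
    by (auto simp: test_function_def)
  have W: "cauchy_weight 1 x > 0" for x :: 'a
    unfolding cauchy_weight_def by (auto intro!: prod_pos add_pos_nonneg)
  have "continuous_on UNIV (\<lambda>x. f x / cauchy_weight 1 x)"
    using W unfolding cauchy_weight_def
    by (intro continuous_intros smooth_continuous f) (auto simp: add_nonneg_eq_0_iff less_imp_neq[symmetric])
  then obtain C where "C > 0" and C: "\<And>x. \<bar>f x / cauchy_weight 1 x\<bar> \<le> C"
    using continuous_bounded_support_bounded[of "\<lambda>x. f x / cauchy_weight 1 x" r] r by auto
  have "\<bar>f x\<bar> \<le> C * cauchy_weight 1 x" for x
    using C[of x] W[of x] by (simp add: abs_div_pos[symmetric] pos_divide_le_eq)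
  with \<open>C > 0\<close> show thesis by (rule that)
qed

text \<open>For \<open>s \<ge> 0\<close> the integrand is the derivative in \<open>s\<close> of
  \<open>- exp (- s) * f (x - s *\<^sub>R e)\<close>, which vanishes for large \<open>s\<close> and
  equals \<open>- f x\<close> at \<open>s = 0\<close>.\<close>

lemma exp_density_representation:
  fixes f :: "'a::euclidean_space \<Rightarrow> real"
  assumes f: "test_function f" and e: "norm e = 1"
  shows "f x = (LINT s|lborel. exp_density s * (f (x - s *\<^sub>R e) + frechet_derivative f (at (x - s *\<^sub>R e)) e))"
proof -
  let ?g = "\<lambda>x. f x + frechet_derivative f (at x) e"
  from f obtain r1 where sf: "smooth f" and r1: "\<And>x. r1 < norm x \<Longrightarrow> f x = 0"
    by (auto simp: test_function_def)
  from test_function_add_derivative[OF f, of e] obtain r2 where sg: "smooth ?g" and r2: "\<And>x. r2 < norm x \<Longrightarrow> ?g x = 0"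
    unfolding test_function_def by blast
  \<comment> \<open>As \<open>e\<close> is a unit vector, \<open>x - s *\<^sub>R e\<close> lies
    outside both supports once \<open>s \<ge> B\<close>; the final 1 makes the inequality
    strict.\<close>
  define B where "B = norm x + max 0 (max r1 r2) + 1"
  have B0: "0 \<le> B" by (simp add: B_def)
  have far: "max r1 r2 < norm (x - s *\<^sub>R e)" if "B \<le> s" for s
  proof -
    have "s \<le> norm (x - s *\<^sub>R e) + norm x"
      using norm_triangle_ineq4[of x "x - s *\<^sub>R e"] e that B0 by simp
    moreover have "max r1 r2 \<le> max 0 (max r1 r2)"
      by simp
    ultimately show ?thesis using that unfolding B_def by linarith
  qed
  have "(LINT s|lborel. exp_density s * ?g (x - s *\<^sub>R e)) =
      (LINT s|lborel. indicator {0..B} s *\<^sub>R (exp (- s) * ?g (x - s *\<^sub>R e)))"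
  proof (rule Bochner_Integration.integral_cong[OF refl])
    fix s
    show "exp_density s * ?g (x - s *\<^sub>R e) = indicator {0..B} s *\<^sub>R (exp (- s) * ?g (x - s *\<^sub>R e))"
      using r2[of "x - s *\<^sub>R e"] far[of s] by (auto simp: exp_density_eq indicator_def)
  qed
  also have "\<dots> = - exp (- B) * f (x - B *\<^sub>R e) - (- exp (- 0) * f (x - 0 *\<^sub>R e))"
  proof (rule integral_FTC_atLeastAtMost[OF B0])
    show "continuous_on {0..B} (\<lambda>s. exp (- s) * ?g (x - s *\<^sub>R e))"
      by (intro continuous_intros continuous_on_compose2[OF smooth_continuous[OF sg]]) auto
    fix s :: real
    have "((\<lambda>s. f (x - s *\<^sub>R e)) has_derivative (\<lambda>h. frechet_derivative f (at (x - s *\<^sub>R e)) (0 - h *\<^sub>R e))) (at s within {0..B})"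
      by (rule has_derivative_compose[OF _ smooth_has_derivative[OF sf]]) (auto intro!: derivative_eq_intros)
    moreover have "(\<lambda>h. frechet_derivative f (at (x - s *\<^sub>R e)) (0 - h *\<^sub>R e)) = (*) (- frechet_derivative f (at (x - s *\<^sub>R e)) e)"
    proof
      fix h
      have bl: "bounded_linear (frechet_derivative f (at (x - s *\<^sub>R e)))"
        by (rule has_derivative_bounded_linear[OF smooth_has_derivative[OF sf]])
      show "frechet_derivative f (at (x - s *\<^sub>R e)) (0 - h *\<^sub>R e) = - frechet_derivative f (at (x - s *\<^sub>R e)) e * h"
        by (simp add: linear_simps[OF bl])
    qed
    ultimately have "((\<lambda>s. f (x - s *\<^sub>R e)) has_real_derivative - frechet_derivative f (at (x - s *\<^sub>R e)) e) (at s within {0..B})"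
      by (simp only: has_field_derivative_def)
    then have "((\<lambda>s. - exp (- s) * f (x - s *\<^sub>R e)) has_real_derivative exp (- s) * ?g (x - s *\<^sub>R e)) (at s within {0..B})"
      by (auto intro!: derivative_eq_intros simp: algebra_simps)
    then show "((\<lambda>s. - exp (- s) * f (x - s *\<^sub>R e)) has_vector_derivative exp (- s) * ?g (x - s *\<^sub>R e)) (at s within {0..B})"
      by (simp add: has_real_derivative_iff_has_vector_derivative)
  qed
  also have "\<dots> = f x"
    using r1[of "x - B *\<^sub>R e"] far[of B] by simp
  finally show ?thesis by simp
qed

text \<open>Each new direction \<open>b\<close> is inverted by
  \<open>exp_density_representation\<close>, which replaces \<open>g\<close> by
  \<open>g + D_b g\<close>, and Fubini merges the new integral with the earlier ones.\<close>

lemma exp_kernel_representation_subset: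
  fixes f :: "'a::euclidean_space \<Rightarrow> real"
  assumes "finite S" "S \<subseteq> Basis" "test_function f"
  shows "\<exists>g. test_function g \<and> (\<forall>x. f x = (LINT s|(\<Pi>\<^sub>M b\<in>S. lborel).
    (\<Prod>b\<in>S. exp_density (s b)) * g (x - (\<Sum>b\<in>S. s b *\<^sub>R b))))"
  using assms
proof (induction S)
  case empty
  then show ?case
    by (intro exI[of _ f]) (simp add: PiM_empty lebesgue_integral_count_space_finite)
next
  case (insert b S)
  interpret product_sigma_finite "\<lambda>_::'a. lborel :: real measure" ..
  from insert obtain g where g: "test_function g"
    and fg: "\<And>x. f x = (LINT s|(\<Pi>\<^sub>M b\<in>S. lborel). (\<Prod>b\<in>S. exp_density (s b)) * g (x - (\<Sum>b\<in>S. s b *\<^sub>R b)))"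
    by auto
  define h where "h = (\<lambda>x. g x + frechet_derivative g (at x) b)"
  have h: "test_function h"
    unfolding h_def by (rule test_function_add_derivative[OF g])
  have gh: "g x = (LINT s|lborel. exp_density s * h (x - s *\<^sub>R b))" for x
    unfolding h_def using insert.prems by (intro exp_density_representation g) auto
  have [measurable]: "h \<in> borel_measurable borel"
    using h by (intro borel_measurable_continuous_onI smooth_continuous) (simp add: test_function_def)
  obtain C where "C > 0" and C: "\<And>x. \<bar>h x\<bar> \<le> C * cauchy_weight 1 x"
    using test_function_bound[OF h] by blast
  have C': "\<bar>h x\<bar> \<le> C" for x
    using order_trans[OF C[of x] mult_left_le[OF cauchy_weight_bounds(2)]] \<open>C > 0\<close> by simp
  show ?case
  proof (intro exI[of _ h] conjI allI h)
    fix x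
    let ?F = "\<lambda>s. (\<Prod>b\<in>insert b S. exp_density (s b)) * h (x - (\<Sum>b\<in>insert b S. s b *\<^sub>R b))"
    have int: "integrable (\<Pi>\<^sub>M b\<in>insert b S. lborel) ?F"
    proof (rule Bochner_Integration.integrable_bound)
      show "integrable (\<Pi>\<^sub>M b\<in>insert b S. lborel) (\<lambda>s. C * (\<Prod>b\<in>insert b S. exp_density (s b)))"
        by (intro integrable_mult_right product_integrable_prod integrable_exp_density) (use insert in auto)
      show "?F \<in> borel_measurable (\<Pi>\<^sub>M b\<in>insert b S. lborel)"
        by measurable
      show "AE s in (\<Pi>\<^sub>M b\<in>insert b S. lborel). norm (?F s) \<le> norm (C * (\<Prod>b\<in>insert b S. exp_density (s b)))"
      proof (rule AE_I2)
        fix s :: "'a \<Rightarrow> real"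
        have "0 \<le> (\<Prod>b\<in>insert b S. exp_density (s b))"
          by (intro prod_nonneg) (simp add: exp_density_bounds)
        then show "norm (?F s) \<le> norm (C * (\<Prod>b\<in>insert b S. exp_density (s b)))"
          using mult_left_mono[OF C'[of "x - (\<Sum>b\<in>insert b S. s b *\<^sub>R b)"], of "\<Prod>b\<in>insert b S. exp_density (s b)"] \<open>C > 0\<close>
          by (simp add: abs_mult mult.commute)
      qed
    qed
    have "(LINT s|(\<Pi>\<^sub>M b\<in>insert b S. lborel). ?F s) = (LINT s|(\<Pi>\<^sub>M b\<in>S. lborel). LINT y|lborel. ?F (s(b := y)))"
      using insert.hyps int by (intro product_integral_insert)
    also have "\<dots> = (LINT s|(\<Pi>\<^sub>M b\<in>S. lborel). (\<Prod>b\<in>S. exp_density (s b)) * g (x - (\<Sum>b\<in>S. s b *\<^sub>R b)))"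
    proof (rule Bochner_Integration.integral_cong[OF refl])
      fix s :: "'a \<Rightarrow> real"
      have 1: "(\<Prod>c\<in>S. exp_density ((s(b := y)) c)) = (\<Prod>c\<in>S. exp_density (s c))" for y
        using insert.hyps by (intro prod.cong) auto
      have 2: "(\<Sum>c\<in>S. (s(b := y)) c *\<^sub>R c) = (\<Sum>c\<in>S. s c *\<^sub>R c)" for y
        using insert.hyps by (intro sum.cong) auto
      have "?F (s(b := y)) = (\<Prod>c\<in>S. exp_density (s c)) * (exp_density y * h ((x - (\<Sum>c\<in>S. s c *\<^sub>R c)) - y *\<^sub>R b))" for y
        unfolding prod.insert[OF insert.hyps] sum.insert[OF insert.hyps] 1 2 by (simp add: algebra_simps)
      then show "(LINT y|lborel. ?F (s(b := y))) = (\<Prod>b\<in>S. exp_density (s b)) * g (x - (\<Sum>b\<in>S. s b *\<^sub>R b))"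
        unfolding gh by simp
    qed
    finally show "f x = (LINT s|(\<Pi>\<^sub>M b\<in>insert b S. lborel). ?F s)"
      by (simp only: fg)
  qed
qed

text \<open>Since \<open>g\<close> is again a test function, the representation can be
  iterated.\<close>

lemma exp_kernel_representation:
  fixes f :: "'a::euclidean_space \<Rightarrow> real"
  assumes f: "test_function f"
  obtains g where "test_function g" "\<And>x. f x = (LINT t|lborel. g (x - t) * exp_kernel t)"
proof -
  from exp_kernel_representation_subset[OF finite_Basis subset_refl f]
  obtain g where g: "test_function g"
    and fg: "\<And>x. f x = (LINT s|(\<Pi>\<^sub>M b\<in>Basis. lborel). (\<Prod>b\<in>Basis. exp_density (s b)) * g (x - (\<Sum>b\<in>Basis. s b *\<^sub>R b)))"
    by blast
  have [measurable]: "g \<in> borel_measurable borel"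
    using g by (intro borel_measurable_continuous_onI smooth_continuous) (simp add: test_function_def)
  have "f x = (LINT t|lborel. g (x - t) * exp_kernel t)" for x
    unfolding fg exp_kernel_def
    by (subst lborel_eq, subst integral_distr) (auto simp: mult.commute intro!: Bochner_Integration.integral_cong)
  with g show thesis by (rule that)
qed

section \<open>The square function and local averages\<close>

definition cauchy_sum :: real where
  "cauchy_sum = 2 * (\<Sum>j. 1 / (1 + (real j)\<^sup>2))"

lemma summable_cauchy: "summable (\<lambda>j. 1 / (1 + (real j)\<^sup>2))"
proof (rule summable_comparison_test')
  show "summable (\<lambda>j. inverse (real j ^ 2))"
    by (rule inverse_power_summable) simp
  show "norm (1 / (1 + (real j)\<^sup>2)) \<le> inverse (real j ^ 2)" if "1 \<le> j" for j
    using that by (auto simp: inverse_eq_divide intro!: divide_left_mono mult_pos_pos add_pos_pos)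
qed

text \<open>The integers on one side of \<open>t\<close> have distances to \<open>t\<close> bounded
  below by distinct natural numbers, so each side is at most the full series; the two sides give the
  factor 2 in \<open>cauchy_sum\<close>.\<close>

lemma sum_cauchy_translates_le:
  fixes F :: "int set"
  assumes "finite F"
  shows "(\<Sum>n\<in>F. 1 / (1 + (t - real_of_int n)\<^sup>2)) \<le> cauchy_sum"
proof -
  let ?f = "\<lambda>n. 1 / (1 + (t - real_of_int n)\<^sup>2)" and ?g = "\<lambda>j. 1 / (1 + (real j)\<^sup>2)"
  have half: "(\<Sum>n\<in>G. ?f n) \<le> (\<Sum>j. ?g j)"
    if "finite G" and inj: "inj_on j G" and le: "\<And>n. n \<in> G \<Longrightarrow> real (j n) \<le> \<bar>t - real_of_int n\<bar>" for G and j :: "int \<Rightarrow> nat"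
  proof -
    have "(\<Sum>n\<in>G. ?f n) \<le> (\<Sum>n\<in>G. ?g (j n))"
    proof (intro sum_mono divide_left_mono add_left_mono)
      fix n assume "n \<in> G"
      then have "(real (j n))\<^sup>2 \<le> \<bar>t - real_of_int n\<bar>\<^sup>2"
        by (intro power_mono le) auto
      then show "(real (j n))\<^sup>2 \<le> (t - real_of_int n)\<^sup>2" by simp
    qed (auto intro!: mult_pos_pos add_pos_nonneg)
    also have "\<dots> = (\<Sum>i\<in>j ` G. ?g i)"
      using inj by (simp add: sum.reindex)
    also have "\<dots> \<le> (\<Sum>j. ?g j)"
      using \<open>finite G\<close> by (intro sum_le_suminf summable_cauchy) (auto intro!: divide_nonneg_nonneg)
    finally show ?thesis .
  qed
  let ?m = "\<lfloor>t\<rfloor>"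
  have "(\<Sum>n\<in>F. ?f n) = (\<Sum>n\<in>F \<inter> {..?m}. ?f n) + (\<Sum>n\<in>F - {..?m}. ?f n)"
    using assms by (intro sum.Int_Diff)
  also have "(\<Sum>n\<in>F \<inter> {..?m}. ?f n) \<le> (\<Sum>j. ?g j)"
    by (rule half[where j = "\<lambda>n. nat (?m - n)"]) (use assms in \<open>auto simp: inj_on_def\<close>, linarith)
  also have "(\<Sum>n\<in>F - {..?m}. ?f n) \<le> (\<Sum>j. ?g j)"
    \<comment> \<open>The first integer above \<open>t\<close> may be arbitrarily close to
      \<open>t\<close>, so it has to be assigned the bound 0.\<close>
    by (rule half[where j = "\<lambda>n. nat (n - ?m - 1)"]) (use assms in \<open>auto simp: inj_on_def\<close>, linarith)
  finally show ?thesis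
    by (simp add: cauchy_sum_def)
qed

lemma cauchy_sum_nonneg: "0 \<le> cauchy_sum"
  using sum_cauchy_translates_le[of "{}" 0] by simp

text \<open>Used for the full frequency lattice and for the grid of points on a sphere; the bound
  depends neither on \<open>z\<close> nor on the sets \<open>F i\<close>.\<close>

lemma sum_prod_cauchy_le:
  fixes z :: "'i \<Rightarrow> real" and F :: "'i \<Rightarrow> int set"
  assumes "finite I" "\<And>i. i \<in> I \<Longrightarrow> finite (F i)"
  shows "(\<Sum>m\<in>Pi\<^sub>E I F. \<Prod>i\<in>I. 1 / (1 + (z i - real_of_int (m i))\<^sup>2)) \<le> cauchy_sum ^ card I"
proof -
  have "(\<Sum>m\<in>Pi\<^sub>E I F. \<Prod>i\<in>I. 1 / (1 + (z i - real_of_int (m i))\<^sup>2)) =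
      (\<Prod>i\<in>I. \<Sum>n\<in>F i. 1 / (1 + (z i - real_of_int n)\<^sup>2))"
    using assms by (subst prod_sum_PiE) auto
  also have "\<dots> \<le> (\<Prod>i\<in>I. cauchy_sum)"
    using assms by (intro prod_mono conjI sum_nonneg sum_cauchy_translates_le) auto
  finally show ?thesis by simp
qed

lemma cauchy_weight_vec:
  "cauchy_weight \<delta> x = (\<Prod>i\<in>UNIV. 1 / (1 + (\<delta> * (x $ i))\<^sup>2))" for x :: "real ^ 'n"
proof -
  have bij: "bij_betw (\<lambda>i::'n. axis i (1::real)) UNIV Basis"
    by (auto simp: bij_betw_def Basis_vec_def inj_on_def axis_eq_axis)
  show ?thesis
    unfolding cauchy_weight_def prod.reindex_bij_betw[OF bij, symmetric] by (simp add: inner_axis)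
qed

lemma sum_cauchy_weight_le:
  fixes K :: "(real ^ 'n) set"
  assumes "finite K" "K \<subseteq> int_lattice"
  shows "(\<Sum>k\<in>K. cauchy_weight 1 (k - t)) \<le> cauchy_sum ^ CARD('n)"
proof -
  let ?F = "\<lambda>i. (\<lambda>k. \<lfloor>k $ i\<rfloor>) ` K"
  let ?j = "\<lambda>k i. \<lfloor>k $ i\<rfloor>"
  have k: "real_of_int \<lfloor>k $ i\<rfloor> = k $ i" if "k \<in> K" for k i
  proof -
    have "k $ i \<in> \<int>"
      using that assms(2) by (auto simp: int_lattice_def)
    then show ?thesis by (auto elim: Ints_cases)
  qed
  have inj: "inj_on ?j K"
  proof (rule inj_onI)
    fix k l assume kl: "k \<in> K" "l \<in> K" "?j k = ?j l"
    have "k $ i = l $ i" for i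
    proof -
      have "real_of_int \<lfloor>k $ i\<rfloor> = real_of_int \<lfloor>l $ i\<rfloor>"
        using fun_cong[OF kl(3), of i] by (rule arg_cong)
      then show ?thesis
        unfolding k[OF kl(1)] k[OF kl(2)] .
    qed
    then show "k = l" by (simp add: vec_eq_iff)
  qed
  have "(\<Sum>k\<in>K. cauchy_weight 1 (k - t)) = (\<Sum>k\<in>K. \<Prod>i\<in>UNIV. 1 / (1 + (t $ i - real_of_int (?j k i))\<^sup>2))"
    by (intro sum.cong refl) (simp add: cauchy_weight_vec k power2_commute)
  also have "\<dots> = (\<Sum>m\<in>?j ` K. \<Prod>i\<in>UNIV. 1 / (1 + (t $ i - real_of_int (m i))\<^sup>2))"
    using inj by (simp add: sum.reindex)
  \<comment> \<open>\<open>K\<close> is enlarged to the box spanned by its coordinate projections,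
    over which the sum of products factors.\<close>
  also have "\<dots> \<le> (\<Sum>m\<in>Pi\<^sub>E UNIV ?F. \<Prod>i\<in>UNIV. 1 / (1 + (t $ i - real_of_int (m i))\<^sup>2))"
    using assms(1) by (intro sum_mono2 finite_PiE prod_nonneg) auto
  also have "\<dots> \<le> cauchy_sum ^ CARD('n)"
    using assms(1) by (intro sum_prod_cauchy_le) auto
  finally show ?thesis .
qed

text \<open>The variance of \<open>f\<close> about its weighted mean \<open>c\<close> is
  nonnegative.\<close>

lemma weighted_cauchy_schwarz:
  fixes w f :: "'a \<Rightarrow> real"
  assumes w: "integrable M w" and f: "integrable M (\<lambda>x. w x * f x)" and f2: "integrable M (\<lambda>x. w x * (f x)\<^sup>2)"
    and nn: "\<And>x. 0 \<le> w x" and pos: "0 < (LINT x|M. w x)"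
  shows "(LINT x|M. w x * f x)\<^sup>2 \<le> (LINT x|M. w x) * (LINT x|M. w x * (f x)\<^sup>2)"
proof -
  let ?W = "LINT x|M. w x" and ?I = "LINT x|M. w x * f x" and ?J = "LINT x|M. w x * (f x)\<^sup>2"
  define c where "c = ?I / ?W"
  have "0 \<le> (LINT x|M. w x * (f x - c)\<^sup>2)"
    using nn by (intro integral_nonneg_AE) auto
  also have "\<dots> = (LINT x|M. (w x * (f x)\<^sup>2 - (2 * c) * (w x * f x)) + c\<^sup>2 * w x)"
    by (intro Bochner_Integration.integral_cong refl) (simp add: power2_eq_square algebra_simps)
  also have "\<dots> = ?J - 2 * c * ?I + c\<^sup>2 * ?W"
    using w f f2 by simp
  also have "\<dots> = ?J - ?I\<^sup>2 / ?W"
    using pos by (simp add: c_def power2_eq_square field_simps)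
  finally show ?thesis
    using pos by (simp add: field_simps)
qed

lemma cauchy_weight_minus_commute: "cauchy_weight \<delta> (x - y) = cauchy_weight \<delta> (y - x)"
  unfolding cauchy_weight_def
  by (intro prod.cong refl) (simp add: inner_diff_left power_mult_distrib power2_commute)

lemma integral_cauchy_weight:
  "(LINT y|lborel. cauchy_weight 1 (y :: 'a::euclidean_space)) = pi ^ DIM('a)"
proof -
  have "complex_of_real (LINT y|lborel. cauchy_weight 1 (y :: 'a)) = of_real (pi ^ DIM('a))"
    using fourier_cauchy_weight[of 1 "0::'a"] by simp
  then show ?thesis by (simp only: of_real_eq_iff)
qed

text \<open>Cauchy-Schwarz against the weight centred at \<open>k\<close>, of mass
  \<open>pi ^ CARD('n)\<close>, bounds each term by a local integral of \<open>|A|^2\<close>. The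
  translated weights add up to at most \<open>cauchy_sum ^ CARD('n)\<close> at every point, so the
  local integrals reassemble into the global one, uniformly in \<open>K\<close>.\<close>

lemma sum_local_integrals_le:
  fixes A :: "real ^ 'n \<Rightarrow> complex" and g :: "real ^ 'n \<Rightarrow> real"
  assumes A: "integrable lborel A" and A2: "integrable lborel (\<lambda>t. (cmod (A t))\<^sup>2)"
    and g: "\<And>x. \<bar>g x\<bar> \<le> C * cauchy_weight 1 x" and K: "finite K" "K \<subseteq> int_lattice"
  shows "(\<Sum>k\<in>K. (cmod (LINT t|lborel. complex_of_real (g (t - k)) * A t))\<^sup>2) \<le>
    C\<^sup>2 * pi ^ CARD('n) * cauchy_sum ^ CARD('n) * (LINT t|lborel. (cmod (A t))\<^sup>2)"
proof -
  have [measurable]: "A \<in> borel_measurable borel"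
    using borel_measurable_integrable[OF A] by simp
  let ?w = "\<lambda>k t. cauchy_weight 1 (k - t) :: real"
  note wb = cauchy_weight_bounds[of 1]
  have w: "integrable lborel (?w k)" "(LINT t|lborel. ?w k t) = pi ^ CARD('n)" for k :: "real ^ 'n"
    by (simp_all add: integrable_lborel_reflect integrable_cauchy_weight integral_lborel_reflect integral_cauchy_weight)
  have wA: "integrable lborel (\<lambda>t. ?w k t * cmod (A t))" for k
    by (rule Bochner_Integration.integrable_bound[OF A]) (auto simp: abs_mult wb intro!: mult_left_le_one_le)
  have wA2: "integrable lborel (\<lambda>t. ?w k t * (cmod (A t))\<^sup>2)" for k
    by (rule Bochner_Integration.integrable_bound[OF A2]) (auto simp: abs_mult wb intro!: mult_left_le_one_le)
  have one: "(cmod (LINT t|lborel. complex_of_real (g (t - k)) * A t))\<^sup>2 \<le>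
      C\<^sup>2 * pi ^ CARD('n) * (LINT t|lborel. ?w k t * (cmod (A t))\<^sup>2)" for k
  proof -
    have "cmod (LINT t|lborel. complex_of_real (g (t - k)) * A t) \<le>
        (LINT t|lborel. cmod (complex_of_real (g (t - k)) * A t))"
      by (rule integral_norm_bound)
    also have "\<dots> \<le> (LINT t|lborel. C * (?w k t * cmod (A t)))"
    proof (rule integral_mono')
      show "integrable lborel (\<lambda>t. C * (?w k t * cmod (A t)))"
        by (intro integrable_mult_right wA)
      show le: "cmod (complex_of_real (g (t - k)) * A t) \<le> C * (?w k t * cmod (A t))" for t
        using mult_right_mono[OF g[of "t - k"], of "cmod (A t)"]
        by (simp add: norm_mult mult.assoc cauchy_weight_minus_commute[of 1 t k])
      show "0 \<le> C * (?w k t * cmod (A t))" for t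
        by (rule order_trans[OF norm_ge_zero le])
    qed
    finally have "cmod (LINT t|lborel. complex_of_real (g (t - k)) * A t) \<le> C * (LINT t|lborel. ?w k t * cmod (A t))"
      by simp
    then have "(cmod (LINT t|lborel. complex_of_real (g (t - k)) * A t))\<^sup>2 \<le> (C * (LINT t|lborel. ?w k t * cmod (A t)))\<^sup>2"
      by (intro power_mono) auto
    also have "\<dots> = C\<^sup>2 * (LINT t|lborel. ?w k t * cmod (A t))\<^sup>2"
      by (simp add: power_mult_distrib)
    also have "\<dots> \<le> C\<^sup>2 * (pi ^ CARD('n) * (LINT t|lborel. ?w k t * (cmod (A t))\<^sup>2))"
      using weighted_cauchy_schwarz[OF w(1) wA wA2 wb(1)] by (intro mult_left_mono) (auto simp: w(2))
    finally show ?thesis by simp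
  qed
  have "(\<Sum>k\<in>K. (cmod (LINT t|lborel. complex_of_real (g (t - k)) * A t))\<^sup>2) \<le>
      (\<Sum>k\<in>K. C\<^sup>2 * pi ^ CARD('n) * (LINT t|lborel. ?w k t * (cmod (A t))\<^sup>2))"
    by (intro sum_mono one)
  also have "\<dots> = C\<^sup>2 * pi ^ CARD('n) * (LINT t|lborel. (\<Sum>k\<in>K. ?w k t) * (cmod (A t))\<^sup>2)"
    using wA2 by (simp add: sum_distrib_left[symmetric] sum_distrib_right)
  also have "\<dots> \<le> C\<^sup>2 * pi ^ CARD('n) * (LINT t|lborel. cauchy_sum ^ CARD('n) * (cmod (A t))\<^sup>2)"
  proof (intro mult_left_mono integral_mono)
    show "integrable lborel (\<lambda>t. (\<Sum>k\<in>K. ?w k t) * (cmod (A t))\<^sup>2)"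
      using wA2 by (simp add: sum_distrib_right)
    show "integrable lborel (\<lambda>t. cauchy_sum ^ CARD('n) * (cmod (A t))\<^sup>2)"
      using A2 by simp
    show "(\<Sum>k\<in>K. ?w k t) * (cmod (A t))\<^sup>2 \<le> cauchy_sum ^ CARD('n) * (cmod (A t))\<^sup>2" for t
      using sum_cauchy_weight_le[OF K] by (intro mult_right_mono) auto
  qed auto
  finally show ?thesis by simp
qed

text \<open>Translation by \<open>k\<close> commutes with the convolution
  \<open>f = g * exp_kernel\<close>, so the same \<open>U\<close> serves for all \<open>k\<close> at
  once.\<close>

lemma integral_test_function_shift:
  fixes f g :: "'a::euclidean_space \<Rightarrow> real"
  assumes U: "integrable lborel U" and g: "test_function g" 
    and fg: "\<And>x. f x = (LINT t|lborel. g (x - t) * exp_kernel t)"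
  shows "(LINT \<xi>|lborel. complex_of_real (f (\<xi> - k)) * U \<xi>) =
    (LINT t|lborel. complex_of_real (g (t - k)) * exp_correlation U t)"
proof -
  obtain C where C: "\<And>x. \<bar>g x\<bar> \<le> C * cauchy_weight 1 x" and "C > 0"
    using test_function_bound[OF g] by blast
  have gC: "cmod (complex_of_real (g (t - k))) \<le> C" for t
    using order_trans[OF C mult_left_le[OF cauchy_weight_bounds(2)]] \<open>C > 0\<close> by simp
  have [measurable]: "g \<in> borel_measurable borel"
    using g by (intro borel_measurable_continuous_onI smooth_continuous) (simp add: test_function_def)
  have "(LINT t|lborel. complex_of_real (g (t - k)) * exp_correlation U t) =
      (LINT \<xi>|lborel. U \<xi> * (LINT t|lborel. complex_of_real (g (\<xi> - t - k)) * of_real (exp_kernel t)))"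
    by (rule integral_mult_exp_correlation[OF U _ gC]) measurable
  also have "\<dots> = (LINT \<xi>|lborel. complex_of_real (f (\<xi> - k)) * U \<xi>)"
  proof (rule Bochner_Integration.integral_cong[OF refl])
    fix \<xi> :: 'a
    have "(LINT t|lborel. complex_of_real (g (\<xi> - t - k)) * of_real (exp_kernel t)) = of_real (f (\<xi> - k))"
      unfolding fg by (subst integral_complex_of_real[symmetric]) (simp add: algebra_simps)
    then show "U \<xi> * (LINT t|lborel. complex_of_real (g (\<xi> - t - k)) * of_real (exp_kernel t)) = complex_of_real (f (\<xi> - k)) * U \<xi>"
      by simp
  qed
  finally show ?thesis ..
qed

text \<open>Three representations of \<open>\<psi>\<close> trade it for \<open>g3\<close> and
  \<open>U\<close> for its third correlation \<open>?A3\<close>; the remaining sum is a sum of local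
  integrals of \<open>?A3\<close>.\<close>

lemma sum_projections_le:
  fixes \<psi> :: "real ^ 'n \<Rightarrow> real"
  assumes "test_function \<psi>"
  obtains C where "C > 0"
    "\<And>U K. integrable lborel U \<Longrightarrow> finite K \<Longrightarrow> K \<subseteq> int_lattice \<Longrightarrow>
      (\<Sum>k\<in>K. (cmod (LINT \<xi>|lborel. complex_of_real (\<psi> (\<xi> - k)) * U \<xi>))\<^sup>2) \<le>
      C * (LINT y|lborel. cauchy_weight 1 y ^ 3 * (cmod (fourier_raw U y))\<^sup>2)"
proof -
  obtain g1 where g1: "test_function g1" "\<And>x. \<psi> x = (LINT t|lborel. g1 (x - t) * exp_kernel t)"
    using exp_kernel_representation[OF assms] by blast
  obtain g2 where g2: "test_function g2" "\<And>x. g1 x = (LINT t|lborel. g2 (x - t) * exp_kernel t)"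
    using exp_kernel_representation[OF g1(1)] by blast
  obtain g3 where g3: "test_function g3" "\<And>x. g2 x = (LINT t|lborel. g3 (x - t) * exp_kernel t)"
    using exp_kernel_representation[OF g2(1)] by blast
  obtain C where C: "C > 0" "\<And>x. \<bar>g3 x\<bar> \<le> C * cauchy_weight 1 x"
    using test_function_bound[OF g3(1)] by blast
  define B where "B = C\<^sup>2 * pi ^ CARD('n) * cauchy_sum ^ CARD('n) * (1 / (2 * pi) ^ CARD('n))"
  have B: "0 \<le> B"
    using cauchy_sum_nonneg by (simp add: B_def)
  have "(\<Sum>k\<in>K. (cmod (LINT \<xi>|lborel. complex_of_real (\<psi> (\<xi> - k)) * U \<xi>))\<^sup>2) \<le>
      (B + 1) * (LINT y|lborel. cauchy_weight 1 y ^ 3 * (cmod (fourier_raw U y))\<^sup>2)"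
    if U: "integrable lborel U" and K: "finite K" "K \<subseteq> int_lattice" for U K
  proof -
    let ?A1 = "exp_correlation U"
    let ?A2 = "exp_correlation ?A1"
    let ?A3 = "exp_correlation ?A2"
    have A1: "integrable lborel ?A1" by (rule integrable_exp_correlation[OF U])
    have A2: "integrable lborel ?A2" by (rule integrable_exp_correlation[OF A1])
    have A3: "integrable lborel ?A3" by (rule integrable_exp_correlation[OF A2])
    have "(LINT \<xi>|lborel. complex_of_real (\<psi> (\<xi> - k)) * U \<xi>) = (LINT t|lborel. complex_of_real (g3 (t - k)) * ?A3 t)" for k
      by (simp only: integral_test_function_shift[OF U g1] integral_test_function_shift[OF A1 g2]
          integral_test_function_shift[OF A2 g3])
    then have "(\<Sum>k\<in>K. (cmod (LINT \<xi>|lborel. complex_of_real (\<psi> (\<xi> - k)) * U \<xi>))\<^sup>2) \<le>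
        C\<^sup>2 * pi ^ CARD('n) * cauchy_sum ^ CARD('n) * (LINT t|lborel. (cmod (?A3 t))\<^sup>2)"
      using sum_local_integrals_le[OF A3 exp_correlation_square(1)[OF A2] C(2) K] by simp
    also have "(LINT t|lborel. (cmod (?A3 t))\<^sup>2) =
        (1 / (2 * pi) ^ CARD('n)) * (LINT y|lborel. cauchy_weight 1 y * (cmod (fourier_raw ?A2 y))\<^sup>2)"
      using exp_correlation_square(2)[OF A2] by simp
    \<comment> \<open>One weight comes from the Plancherel identity for the outermost correlation,
      one from each of the two inner ones: hence the cube.\<close>
    also have "(\<lambda>y. cauchy_weight 1 y * (cmod (fourier_raw ?A2 y))\<^sup>2) =
        (\<lambda>y. cauchy_weight 1 y ^ 3 * (cmod (fourier_raw U y))\<^sup>2)"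
      unfolding fourier_raw_exp_correlation[OF A1] fourier_raw_exp_correlation[OF U]
      by (simp add: fun_eq_iff power3_eq_cube)
    finally have *: "(\<Sum>k\<in>K. (cmod (LINT \<xi>|lborel. complex_of_real (\<psi> (\<xi> - k)) * U \<xi>))\<^sup>2) \<le>
        B * (LINT y|lborel. cauchy_weight 1 y ^ 3 * (cmod (fourier_raw U y))\<^sup>2)"
      by (simp add: B_def)
    \<comment> \<open>\<open>B\<close> is only known to be nonnegative, while the constant has to be
      positive.\<close>
    also have "\<dots> \<le> (B + 1) * (LINT y|lborel. cauchy_weight 1 y ^ 3 * (cmod (fourier_raw U y))\<^sup>2)"
      by (intro mult_right_mono integral_nonneg_AE AE_I2 mult_nonneg_nonneg zero_le_power cauchy_weight_bounds) auto
    finally show ?thesis .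
  qed
  with B show thesis
    by (intro that[of "B + 1"]) auto
qed

section \<open>Averaging over rotations\<close>

lemma orthogonal_transformation_measurable:
  fixes T :: "'a::euclidean_space \<Rightarrow> 'a"
  assumes "orthogonal_transformation T"
  shows "T \<in> borel_measurable borel"
  using assms by (intro borel_measurable_continuous_onI)
    (simp add: linear_continuous_on linear_conv_bounded_linear[symmetric] orthogonal_transformation_linear)

lemma distr_lborel_orthogonal:
  fixes T :: "real ^ 'n::{finite, wellorder} \<Rightarrow> real ^ 'n::_"
  assumes T: "orthogonal_transformation T"
  shows "distr lborel borel T = lborel"
proof (rule sym, rule lborel_eqI)
  have [measurable]: "T \<in> borel_measurable borel"
    by (rule orthogonal_transformation_measurable[OF T])
  fix l u :: "real ^ 'n::_"
  assume le: "\<And>b. b \<in> Basis \<Longrightarrow> l \<bullet> b \<le> u \<bullet> b"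
  let ?S = "T -` box l u"
  have S: "?S = inv T ` box l u"
    by (rule bij_vimage_eq_inv_image[OF orthogonal_transformation_bij[OF T]])
  have S_borel: "?S \<in> sets borel"
    using measurable_sets_borel[of T borel "box l u"] by simp
  have lm: "inv T ` box l u \<in> lmeasurable"
    by (intro measurable_orthogonal_image orthogonal_transformation_inv T) simp
  have "emeasure (distr lborel borel T) (box l u) = emeasure lebesgue ?S"
    using S_borel by (simp add: emeasure_distr)
  also have "\<dots> = emeasure lebesgue (box l u)"
    unfolding S emeasure_eq_measure2[OF lm] emeasure_eq_measure2[OF lmeasurable_box]
    by (subst measure_orthogonal_image[OF orthogonal_transformation_inv[OF T]]) auto
  also have "\<dots> = (\<Prod>b\<in>Basis. (u - l) \<bullet> b)"
    using le by simp
  finally show "emeasure (distr lborel borel T) (box l u) = (\<Prod>b\<in>Basis. (u - l) \<bullet> b)" .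
qed simp

lemma
  fixes T :: "real ^ 'n::{finite, wellorder} \<Rightarrow> real ^ 'n::_"
  assumes T: "orthogonal_transformation T"
  shows nn_integral_lborel_orthogonal:
      "h \<in> borel_measurable borel \<Longrightarrow> (\<integral>\<^sup>+x. h (T x) \<partial>lborel) = (\<integral>\<^sup>+x. h x \<partial>lborel)"
    and integral_lborel_orthogonal:
      "f \<in> borel_measurable borel \<Longrightarrow> (LINT x|lborel. f (T x)) = (LINT x|lborel. f x :: complex)"
    and AE_lborel_orthogonal: "AE x in lborel. P x \<Longrightarrow> AE x in lborel. P (T x)"
proof -
  have [measurable]: "T \<in> borel_measurable borel"
    by (rule orthogonal_transformation_measurable[OF T])
  show "(\<integral>\<^sup>+x. h (T x) \<partial>lborel) = (\<integral>\<^sup>+x. h x \<partial>lborel)" if [measurable]: "h \<in> borel_measurable borel"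
    by (subst (2) distr_lborel_orthogonal[OF T, symmetric]) (simp add: nn_integral_distr)
  show "(LINT x|lborel. f (T x)) = (LINT x|lborel. f x)" if [measurable]: "f \<in> borel_measurable borel"
    by (subst (2) distr_lborel_orthogonal[OF T, symmetric]) (simp add: integral_distr)
  show "AE x in lborel. P (T x)" if "AE x in lborel. P x"
  proof -
    have "AE x in distr lborel borel T. P x"
      using that by (subst distr_lborel_orthogonal[OF T])
    then show ?thesis
      by (rule AE_distrD[rotated]) simp
  qed
qed

text \<open>Changing variables by \<open>T\<close> leaves the phase unchanged. Invariance of
  \<open>U\<close> almost everywhere suffices for invariance of the transform at every point, which
  is the form the averaging argument uses.\<close>

lemma fourier_raw_orthogonal:
  fixes U :: "real ^ 'n::{finite, wellorder} \<Rightarrow> complex"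
  assumes T: "orthogonal_transformation T" and [measurable]: "U \<in> borel_measurable borel"
    and inv: "AE x in lborel. U (T x) = U x"
  shows "fourier_raw U (T y) = fourier_raw U y"
proof -
  have [measurable]: "T \<in> borel_measurable borel"
    by (rule orthogonal_transformation_measurable[OF T])
  have "fourier_raw U (T y) = (LINT \<xi>|lborel. U (T \<xi>) * cis (- (T y \<bullet> T \<xi>)))"
    unfolding fourier_raw_def
    by (rule integral_lborel_orthogonal[OF T, where f = "\<lambda>\<xi>. U \<xi> * cis (- (T y \<bullet> \<xi>))", symmetric]) measurable
  also have "\<dots> = (LINT \<xi>|lborel. U \<xi> * cis (- (y \<bullet> \<xi>)))"
    by (rule integral_cong_AE; (measurable)?)
       (use inv T in \<open>auto simp: orthogonal_transformation_def elim!: eventually_mono\<close>)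
  finally show ?thesis by (simp add: fourier_raw_def)
qed

lemma prod_one_plus_ge: "(\<And>i. i \<in> A \<Longrightarrow> 0 \<le> f i) \<Longrightarrow> 1 + (\<Sum>i\<in>A. f i) \<le> (\<Prod>i\<in>A. 1 + (f i :: real))"
proof (induction A rule: infinite_finite_induct)
  case (insert i A)
  have "1 + (f i + (\<Sum>i\<in>A. f i)) \<le> (1 + f i) * (1 + (\<Sum>i\<in>A. f i))"
    using insert.prems by (simp add: algebra_simps sum_nonneg)
  also have "\<dots> \<le> (1 + f i) * (\<Prod>i\<in>A. 1 + f i)"
    using insert by (intro mult_left_mono) auto
  finally show ?case using insert.hyps by simp
qed auto

text \<open>Expanding the product of the \<open>1 + (z \<bullet> b)^2\<close> produces at least
  \<open>1 + |z|^2\<close>. The product weight is not rotation invariant, but this majorant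
  is.\<close>

lemma cauchy_weight_le_radial: "cauchy_weight 1 z \<le> 1 / (1 + (norm z)\<^sup>2)"
proof -
  have "(norm z)\<^sup>2 = (\<Sum>b\<in>Basis. (z \<bullet> b)\<^sup>2)"
    unfolding power2_norm_eq_inner by (subst euclidean_inner) (simp add: power2_eq_square)
  then have "1 + (norm z)\<^sup>2 \<le> (\<Prod>b\<in>Basis. 1 + (z \<bullet> b)\<^sup>2)"
    using prod_one_plus_ge[of Basis "\<lambda>b. (z \<bullet> b)\<^sup>2"] by simp
  moreover have "0 < 1 + (norm z)\<^sup>2"
    by (simp add: add_pos_nonneg)
  ultimately show ?thesis
    by (simp add: cauchy_weight_def prod_dividef frac_le)
qed

text \<open>Since \<open>V\<close> is rotation invariant, \<open>x\<close> may be replaced by any point of the sphere of radius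
  \<open>norm x\<close>. We sum over the points \<open>y m\<close> of this sphere that lie over an integer grid in three of the
  coordinates: there are at least \<open>(norm x / 2) ^ 3\<close> of them, but they are so far apart that the
  translates of the weight have a bounded sum.\<close>

lemma radial_weight_average:
  fixes V :: "real ^ 4 \<Rightarrow> complex"
  assumes [measurable]: "V \<in> borel_measurable borel"
    and inv: "\<And>T z. orthogonal_transformation T \<Longrightarrow> V (T z) = V z"
  shows "ennreal ((norm x / 2) ^ 3) * (\<integral>\<^sup>+z. ennreal ((cmod (V z))\<^sup>2 * (1 / (1 + (norm (x - z))\<^sup>2)) ^ 3) \<partial>lborel)
    \<le> ennreal (cauchy_sum ^ 3) * (\<integral>\<^sup>+z. ennreal ((cmod (V z))\<^sup>2) \<partial>lborel)"
proof -
  let ?\<rho> = "\<lambda>z::real^4. (1 / (1 + (norm z)\<^sup>2)) ^ 3"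
  let ?J = "\<lambda>y. \<integral>\<^sup>+z. ennreal ((cmod (V z))\<^sup>2 * ?\<rho> (y - z)) \<partial>lborel"
  have J_eq: "?J y = ?J x" if "norm y = norm x" for y
  proof -
    obtain T where T: "orthogonal_transformation T" "T y = x"
      using orthogonal_transformation_exists[of y x] \<open>norm y = norm x\<close> by blast
    have "norm (x - T z) = norm (y - z)" for z
      using T by (metis linear_diff orthogonal_transformation_linear orthogonal_transformation_norm)
    then have "?J y = (\<integral>\<^sup>+z. ennreal ((cmod (V (T z)))\<^sup>2 * ?\<rho> (x - T z)) \<partial>lborel)"
      by (simp add: inv[OF T(1)])
    also have "\<dots> = ?J x"
      by (rule nn_integral_lborel_orthogonal[OF T(1), where h = "\<lambda>z. ennreal ((cmod (V z))\<^sup>2 * ?\<rho> (x - z))"]) measurable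
    finally show ?thesis .
  qed
  \<comment> \<open>Coordinate 0 is left out of the grid; it is determined by the sphere.\<close>
  define I where "I = (UNIV :: 4 set) - {0}"
  have cI: "card I = 3"
    by (simp add: I_def card_Diff_subset)
  have finI: "finite I"
    by (simp add: I_def)
  \<comment> \<open>With each of three coordinates at most \<open>norm x / 2\<close>, their squares
    add up to at most three quarters of \<open>(norm x)^2\<close>, so the square root in
    \<open>y\<close> is taken of a nonnegative number.\<close>
  define N where "N = \<lfloor>norm x / 2\<rfloor>"
  have N0: "0 \<le> N" by (simp add: N_def)
  define G where "G = Pi\<^sub>E I (\<lambda>_. {- N..N})"
  define y where "y m = (\<chi> i. if i = 0 then sqrt ((norm x)\<^sup>2 - (\<Sum>i\<in>I. (real_of_int (m i))\<^sup>2)) else real_of_int (m i))" for m :: "4 \<Rightarrow> int"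
  have yI: "y m $ i = real_of_int (m i)" if "i \<in> I" for m i
    using that by (simp add: y_def I_def)
  have finG: "finite G"
    unfolding G_def I_def by (intro finite_PiE) auto
  have ny: "norm (y m) = norm x" if "m \<in> G" for m
  proof -
    have "(real_of_int (m i))\<^sup>2 \<le> (norm x / 2)\<^sup>2" if "i \<in> I" for i
    proof -
      have "\<bar>m i\<bar> \<le> N"
        using \<open>m \<in> G\<close> that by (auto simp: G_def abs_le_iff dest!: PiE_mem)
      then have "\<bar>real_of_int (m i)\<bar> \<le> norm x / 2"
        unfolding N_def by linarith
      then show ?thesis
        by (simp only: abs_le_square_iff[symmetric])
    qed
    then have "(\<Sum>i\<in>I. (real_of_int (m i))\<^sup>2) \<le> real (card I) * (norm x / 2)\<^sup>2"
      by (rule sum_bounded_above)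
    also have "\<dots> \<le> (norm x)\<^sup>2"
      by (simp add: cI power_divide)
    finally have le: "(\<Sum>i\<in>I. (real_of_int (m i))\<^sup>2) \<le> (norm x)\<^sup>2" .
    have "(norm (y m))\<^sup>2 = (\<Sum>i\<in>UNIV. (y m $ i)\<^sup>2)"
      unfolding power2_norm_eq_inner inner_vec_def by (simp add: power2_eq_square)
    also have "\<dots> = (y m $ 0)\<^sup>2 + (\<Sum>i\<in>I. (y m $ i)\<^sup>2)"
      unfolding I_def by (rule sum.remove) auto
    also have "(\<Sum>i\<in>I. (y m $ i)\<^sup>2) = (\<Sum>i\<in>I. (real_of_int (m i))\<^sup>2)"
      by (intro sum.cong refl) (simp add: yI)
    also have "(y m $ 0)\<^sup>2 = (norm x)\<^sup>2 - (\<Sum>i\<in>I. (real_of_int (m i))\<^sup>2)"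
      using le by (simp add: y_def)
    finally show ?thesis by simp
  qed
  \<comment> \<open>Each coordinate takes \<open>2 * N + 1\<close> values. The count includes 0, so
    the bound also holds for small \<open>x\<close>, where \<open>N = 0\<close>.\<close>
  have "norm x / 2 \<le> real_of_int (2 * N + 1)"
    using N0 unfolding N_def by linarith
  then have "(norm x / 2) ^ 3 \<le> real_of_int (2 * N + 1) ^ 3"
    by (intro power_mono) auto
  also have "\<dots> = real (card G)"
    using N0 unfolding G_def by (simp add: card_PiE[OF finI] cI)
  finally have card: "(norm x / 2) ^ 3 \<le> real (card G)" .
  have sum_le: "(\<Sum>m\<in>G. ?\<rho> (y m - z)) \<le> cauchy_sum ^ 3" for z
  proof -
    have "(\<Sum>m\<in>G. ?\<rho> (y m - z)) \<le> (\<Sum>m\<in>G. \<Prod>i\<in>I. 1 / (1 + (z $ i - real_of_int (m i))\<^sup>2))"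
    proof (intro sum_mono)
      fix m
      \<comment> \<open>The cube is distributed over the three grid coordinates, one factor each,
        and in each factor the norm is bounded below by that coordinate of the difference.\<close>
      have "?\<rho> (y m - z) = (\<Prod>i\<in>I. 1 / (1 + (norm (y m - z))\<^sup>2))"
        by (simp add: cI)
      also have "\<dots> \<le> (\<Prod>i\<in>I. 1 / (1 + (z $ i - real_of_int (m i))\<^sup>2))"
      proof (intro prod_mono conjI)
        fix i assume "i \<in> I"
        have "\<bar>z $ i - real_of_int (m i)\<bar> \<le> norm (y m - z)"
          using component_le_norm_cart[of "y m - z" i] \<open>i \<in> I\<close> by (simp add: yI abs_minus_commute)
        then have "(z $ i - real_of_int (m i))\<^sup>2 \<le> (norm (y m - z))\<^sup>2"
          by (metis abs_ge_zero power2_abs power_mono)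
        then show "1 / (1 + (norm (y m - z))\<^sup>2) \<le> 1 / (1 + (z $ i - real_of_int (m i))\<^sup>2)"
          by (intro divide_left_mono add_left_mono mult_pos_pos add_pos_nonneg) auto
      qed auto
      finally show "?\<rho> (y m - z) \<le> (\<Prod>i\<in>I. 1 / (1 + (z $ i - real_of_int (m i))\<^sup>2))" .
    qed
    also have "\<dots> \<le> cauchy_sum ^ card I"
      unfolding G_def by (rule sum_prod_cauchy_le) (auto simp: I_def)
    finally show ?thesis by (simp add: cI)
  qed
  have "ennreal ((norm x / 2) ^ 3) * ?J x \<le> of_nat (card G) * ?J x"
    using card by (intro mult_right_mono) (auto simp: ennreal_of_nat_eq_real_of_nat)
  also have "\<dots> = (\<Sum>m\<in>G. ?J (y m))"
    unfolding sum_constant[symmetric] by (intro sum.cong refl J_eq[symmetric] ny)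
  also have "\<dots> = (\<integral>\<^sup>+z. (\<Sum>m\<in>G. ennreal ((cmod (V z))\<^sup>2 * ?\<rho> (y m - z))) \<partial>lborel)"
    by (rule nn_integral_sum[symmetric]) measurable
  also have "\<dots> \<le> (\<integral>\<^sup>+z. ennreal (cauchy_sum ^ 3) * ennreal ((cmod (V z))\<^sup>2) \<partial>lborel)"
  proof (rule nn_integral_mono)
    fix z
    have "(\<Sum>m\<in>G. ennreal ((cmod (V z))\<^sup>2 * ?\<rho> (y m - z))) = ennreal (\<Sum>m\<in>G. (cmod (V z))\<^sup>2 * ?\<rho> (y m - z))"
      by (rule sum_ennreal) auto
    also have "\<dots> \<le> ennreal (cauchy_sum ^ 3 * (cmod (V z))\<^sup>2)"
      using mult_left_mono[OF sum_le[of z], of "(cmod (V z))\<^sup>2"]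
      by (intro ennreal_leI) (simp add: sum_distrib_left mult.commute)
    also have "\<dots> = ennreal (cauchy_sum ^ 3) * ennreal ((cmod (V z))\<^sup>2)"
      using cauchy_sum_nonneg by (intro ennreal_mult) auto
    finally show "(\<Sum>m\<in>G. ennreal ((cmod (V z))\<^sup>2 * ?\<rho> (y m - z))) \<le> ennreal (cauchy_sum ^ 3) * ennreal ((cmod (V z))\<^sup>2)" .
  qed
  also have "\<dots> = ennreal (cauchy_sum ^ 3) * (\<integral>\<^sup>+z. ennreal ((cmod (V z))\<^sup>2) \<partial>lborel)"
    by (rule nn_integral_cmult) measurable
  finally show ?thesis .
qed

section \<open>The Fourier transform of radial functions\<close>

lemma L2_limit_unique:
  fixes g1 g2 :: "'a::euclidean_space \<Rightarrow> complex" and h :: "real \<Rightarrow> 'a \<Rightarrow> complex"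
  assumes [measurable]: "g1 \<in> borel_measurable borel" "g2 \<in> borel_measurable borel"
      "\<And>R. h R \<in> borel_measurable borel"
    and l1: "((\<lambda>R. \<integral>\<^sup>+\<xi>. ennreal ((cmod (g1 \<xi> - h R \<xi>))\<^sup>2) \<partial>lborel) \<longlongrightarrow> 0) at_top"
    and l2: "((\<lambda>R. \<integral>\<^sup>+\<xi>. ennreal ((cmod (g2 \<xi> - h R \<xi>))\<^sup>2) \<partial>lborel) \<longlongrightarrow> 0) at_top"
  shows "AE \<xi> in lborel. g1 \<xi> = g2 \<xi>"
proof -
  let ?D = "\<lambda>g R. \<integral>\<^sup>+\<xi>. ennreal ((cmod (g \<xi> - h R \<xi>))\<^sup>2) \<partial>lborel"
  let ?I = "\<integral>\<^sup>+\<xi>. ennreal ((cmod (g1 \<xi> - g2 \<xi>))\<^sup>2) \<partial>lborel"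
  have bound: "?I \<le> 2 * (?D g1 R + ?D g2 R)" for R
  proof -
    have "?I \<le> (\<integral>\<^sup>+\<xi>. 2 * (ennreal ((cmod (g1 \<xi> - h R \<xi>))\<^sup>2) + ennreal ((cmod (g2 \<xi> - h R \<xi>))\<^sup>2)) \<partial>lborel)"
    proof (rule nn_integral_mono)
      fix \<xi>
      let ?a = "cmod (g1 \<xi> - h R \<xi>)" and ?b = "cmod (g2 \<xi> - h R \<xi>)"
      have "cmod (g1 \<xi> - g2 \<xi>) \<le> ?a + ?b"
        using norm_triangle_ineq4[of "g1 \<xi> - h R \<xi>" "g2 \<xi> - h R \<xi>"] by simp
      then have "(cmod (g1 \<xi> - g2 \<xi>))\<^sup>2 \<le> (?a + ?b)\<^sup>2"
        by (intro power_mono) auto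
      also have "\<dots> \<le> 2 * (?a\<^sup>2 + ?b\<^sup>2)"
        using sum_squares_bound[of ?a ?b] by (simp add: power2_sum)
      finally have "ennreal ((cmod (g1 \<xi> - g2 \<xi>))\<^sup>2) \<le> ennreal (2 * (?a\<^sup>2 + ?b\<^sup>2))"
        by (rule ennreal_leI)
      then show "ennreal ((cmod (g1 \<xi> - g2 \<xi>))\<^sup>2) \<le> 2 * (ennreal (?a\<^sup>2) + ennreal (?b\<^sup>2))"
        by (simp add: ennreal_mult)
    qed
    also have "\<dots> = 2 * (?D g1 R + ?D g2 R)"
      by (simp add: nn_integral_cmult nn_integral_add)
    finally show ?thesis .
  qed
  have "((\<lambda>R. 2 * (?D g1 R + ?D g2 R)) \<longlongrightarrow> 2 * (0 + 0)) at_top"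
    by (intro ennreal_tendsto_cmult tendsto_add l1 l2) simp
  then have "?I \<le> 2 * (0 + 0)"
    by (rule tendsto_lowerbound[OF _ always_eventually[OF allI[OF bound]]]) simp
  then have "?I = 0" by simp
  then have "AE \<xi> in lborel. ennreal ((cmod (g1 \<xi> - g2 \<xi>))\<^sup>2) = 0"
    by (subst (asm) nn_integral_0_iff_AE) auto
  then show ?thesis
    by (rule AE_mp) (simp add: ennreal_eq_0_iff)
qed

lemma fourier_integral_eq: 
  "fourier_integral h \<xi> = complex_of_real ((1 / sqrt (2 * pi)) ^ DIM('a)) * fourier_raw h (\<xi> :: 'a::euclidean_space)"
  unfolding fourier_integral_def fourier_raw_def by (simp add: inner_commute mult.commute)

lemma fourier_integral_measurable [measurable]:
  assumes [measurable]: "h \<in> borel_measurable borel"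
  shows "fourier_integral h \<in> borel_measurable borel"
  unfolding fourier_integral_eq[abs_def] by measurable

text \<open>\<open>fourier f\<close> is picked by choice; uniqueness transfers properties of any
  other transform of \<open>f\<close> to it.\<close>

lemma has_fourier_transform_unique:
  assumes "has_fourier_transform f g1" "has_fourier_transform f g2"
  shows "AE \<xi> in lborel. g1 \<xi> = g2 \<xi>"
proof -
  have [measurable]: "f \<in> borel_measurable borel"
    using assms by (simp add: has_fourier_transform_def square_integrable_def)
  have [measurable]: "ball 0 R \<in> sets borel" for R :: real
    by simp
  have m: "fourier_integral (\<lambda>x. indicator (ball 0 R) x * f x) \<in> borel_measurable borel" for R :: real
    by measurable
  show ?thesis
    by (rule L2_limit_unique[where h = "\<lambda>R. fourier_integral (\<lambda>x. indicator (ball 0 R) x * f x)"])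
       (use assms in \<open>simp_all add: m has_fourier_transform_def square_integrable_def\<close>)
qed

text \<open>Truncation to centred balls preserves radial symmetry, so the transforms of the
  truncations are invariant under \<open>T\<close> at every point. Hence \<open>g\<close> composed
  with \<open>T\<close> is a limit of the same family as \<open>g\<close>.\<close>

lemma has_fourier_transform_orthogonal:
  fixes f g :: "real ^ 'n::{finite, wellorder} \<Rightarrow> complex"
  assumes f: "has_fourier_transform f g" and rad: "radial f" and T: "orthogonal_transformation T"
  shows "AE \<xi> in lborel. g (T \<xi>) = g \<xi>"
proof -
  have [measurable]: "T \<in> borel_measurable borel" "f \<in> borel_measurable borel" "g \<in> borel_measurable borel"
    using f orthogonal_transformation_measurable[OF T] by (auto simp: has_fourier_transform_def square_integrable_def)
  have [measurable]: "ball 0 R \<in> sets borel" for R :: real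
    by simp
  let ?h = "\<lambda>R::real. fourier_integral (\<lambda>x. indicator (ball 0 R) x * f x)"
  obtain F where F: "AE x in lborel. f x = F (norm x)"
    using rad by (auto simp: radial_def)
  have fT: "AE x in lborel. f (T x) = f x"
    using F AE_lborel_orthogonal[OF T F] by eventually_elim (simp add: orthogonal_transformation_norm[OF T])
  have hT: "?h R (T \<xi>) = ?h R \<xi>" for R \<xi>
    unfolding fourier_integral_eq
    by (subst fourier_raw_orthogonal[OF T])
       (use fT in \<open>auto simp: indicator_def orthogonal_transformation_norm[OF T] elim!: eventually_mono\<close>)
  have l: "((\<lambda>R. \<integral>\<^sup>+\<xi>. ennreal ((cmod (g \<xi> - ?h R \<xi>))\<^sup>2) \<partial>lborel) \<longlongrightarrow> 0) at_top"
    using f by (simp add: has_fourier_transform_def)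
  have "(\<integral>\<^sup>+\<xi>. ennreal ((cmod (g (T \<xi>) - ?h R \<xi>))\<^sup>2) \<partial>lborel) = (\<integral>\<^sup>+\<xi>. ennreal ((cmod (g \<xi> - ?h R \<xi>))\<^sup>2) \<partial>lborel)" for R
    using nn_integral_lborel_orthogonal[OF T, of "\<lambda>\<xi>. ennreal ((cmod (g \<xi> - ?h R \<xi>))\<^sup>2)"] by (simp add: hT)
  with l have "((\<lambda>R. \<integral>\<^sup>+\<xi>. ennreal ((cmod (g (T \<xi>) - ?h R \<xi>))\<^sup>2) \<partial>lborel) \<longlongrightarrow> 0) at_top"
    by simp
  then show ?thesis
    by (rule L2_limit_unique[rotated 3, OF _ l]) measurable
qed

lemma sobolev_fourier:
  assumes "f \<in> sobolev s" "s > 0"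
  shows "has_fourier_transform f (fourier f)"
    and "(\<integral>\<^sup>+\<xi>. ennreal ((cmod (fourier f \<xi>))\<^sup>2) \<partial>lborel) \<le> ennreal ((sobolev_norm s f)\<^sup>2)"
proof -
  from assms obtain g where g: "has_fourier_transform f g"
    and int: "integrable lborel (\<lambda>\<xi>. (1 + (norm \<xi>)\<^sup>2) powr s * (norm (g \<xi>))\<^sup>2)"
    by (auto simp: sobolev_def)
  show ff: "has_fourier_transform f (fourier f)"
    unfolding fourier_def by (rule someI[where P = "has_fourier_transform f", OF g])
  have [measurable]: "fourier f \<in> borel_measurable borel"
    using ff by (simp add: has_fourier_transform_def square_integrable_def)
  let ?w = "\<lambda>\<xi>. (1 + (norm \<xi>)\<^sup>2) powr s * (norm (fourier f \<xi>))\<^sup>2"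
  \<comment> \<open>Membership in \<open>sobolev s\<close> speaks of some transform
    \<open>g\<close>, the norm of the chosen one. Integrability ensures that the integral in the
    norm is not a default 0.\<close>
  have "integrable lborel ?w"
    by (rule integrable_cong_AE_imp[OF int])
       (use has_fourier_transform_unique[OF g ff] in \<open>auto elim!: eventually_mono\<close>)
  then have "(\<integral>\<^sup>+\<xi>. ennreal (?w \<xi>) \<partial>lborel) = ennreal (LINT \<xi>|lborel. ?w \<xi>)"
    by (rule nn_integral_eq_integral) auto
  moreover have "(\<integral>\<^sup>+\<xi>. ennreal ((cmod (fourier f \<xi>))\<^sup>2) \<partial>lborel) \<le> (\<integral>\<^sup>+\<xi>. ennreal (?w \<xi>) \<partial>lborel)"
  proof (intro nn_integral_mono ennreal_leI)
    fix \<xi> :: 'a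
    have "1 \<le> (1 + (norm \<xi>)\<^sup>2) powr s"
      using assms(2) by (intro ge_one_powr_ge_zero) auto
    then show "(cmod (fourier f \<xi>))\<^sup>2 \<le> ?w \<xi>"
      using mult_right_mono[of 1 "(1 + (norm \<xi>)\<^sup>2) powr s" "(cmod (fourier f \<xi>))\<^sup>2"] by simp
  qed
  moreover have "0 \<le> (LINT \<xi>|lborel. ?w \<xi>)"
    by (intro integral_nonneg_AE) auto
  ultimately show "(\<integral>\<^sup>+\<xi>. ennreal ((cmod (fourier f \<xi>))\<^sup>2) \<partial>lborel) \<le> ennreal ((sobolev_norm s f)\<^sup>2)"
    by (simp add: sobolev_norm_def)
qed

section \<open>The radial estimate\<close>

lemma countable_int_lattice: "countable (int_lattice :: (real ^ 'n) set)"
proof -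
  have "int_lattice \<subseteq> range (\<lambda>f::'n \<Rightarrow> int. \<chi> i. real_of_int (f i))"
  proof
    fix k :: "real ^ 'n"
    assume "k \<in> int_lattice"
    then have fl: "real_of_int \<lfloor>k $ i\<rfloor> = k $ i" for i
      by (auto simp: int_lattice_def elim: Ints_cases[of "k $ i"])
    have "k = (\<chi> i. real_of_int \<lfloor>k $ i\<rfloor>)"
      by (simp only: vec_eq_iff vec_lambda_beta fl) simp
    then show "k \<in> range (\<lambda>f::'n \<Rightarrow> int. \<chi> i. real_of_int (f i))"
      by (rule image_eqI[where x = "\<lambda>i. \<lfloor>k $ i\<rfloor>"]) simp
  qed
  then show ?thesis
    by (rule countable_subset) simp
qed

text \<open>The infinite sum is the supremum over the finite subsets of a countable lattice, hence a
  countable supremum. The measurability is a premise of \<open>esssup_I\<close>.\<close>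

lemma square_function_measurable:
  fixes \<psi> :: "real ^ 'n \<Rightarrow> real"
  assumes [measurable]: "\<psi> \<in> borel_measurable borel" "fourier f \<in> borel_measurable borel"
  shows "square_function \<psi> f \<in> borel_measurable borel"
proof -
  have [measurable]: "unit_proj \<psi> k f \<in> borel_measurable borel" for k
    unfolding unit_proj_def inverse_fourier_integral_def[abs_def] by measurable
  have "(\<lambda>x. \<Sum>\<^sub>\<infinity>k\<in>int_lattice. ennreal ((norm (unit_proj \<psi> k f x))\<^sup>2)) =
      (\<lambda>x. SUP F\<in>{F. finite F \<and> F \<subseteq> int_lattice}. \<Sum>k\<in>F. ennreal ((norm (unit_proj \<psi> k f x))\<^sup>2))"
    by (subst nonneg_infsum_complete) auto
  also have "\<dots> \<in> borel_measurable borel"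
    by (intro borel_measurable_SUP countable_Collect_finite_subset countable_int_lattice) measurable
  finally have [measurable]: "(\<lambda>x. \<Sum>\<^sub>\<infinity>k\<in>int_lattice. ennreal ((norm (unit_proj \<psi> k f x))\<^sup>2)) \<in> borel_measurable borel" .
  show ?thesis
    unfolding square_function_def[abs_def] ennreal_sqrt_def by measurable
qed

lemma ennreal_sqrt_le:
  assumes "x \<le> ennreal b"
  shows "ennreal_sqrt x \<le> ennreal (sqrt b)"
proof -
  have "x < \<infinity>"
    using assms by (metis ennreal_less_top infinity_ennreal_def le_less_trans)
  \<comment> \<open>For negative \<open>b\<close>, \<open>ennreal b\<close> is 0 and forces
    \<open>x = 0\<close>.\<close>
  then have "enn2real x \<le> b \<or> enn2real x = 0"
    using assms by (cases x; cases "0 \<le> b") (auto simp: ennreal_neg)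
  then show ?thesis
  proof
    assume "enn2real x \<le> b"
    then show ?thesis
      using \<open>x < \<infinity>\<close> by (auto simp: ennreal_sqrt_def intro!: ennreal_leI)
  qed (use \<open>x < \<infinity>\<close> in \<open>auto simp: ennreal_sqrt_def\<close>)
qed

text \<open>\<open>proj\<close> is applied to a truncation of \<open>fourier f\<close>, modulated so
  that the weight is centred at \<open>x\<close>. The averaging lemma and the bound
  \<open>fourier_raw_square_le\<close> then apply to the transform \<open>V\<close> of the
  truncation.\<close>

lemma sum_unit_proj_le:
  fixes \<psi> :: "real ^ 4 \<Rightarrow> real" and f :: "real ^ 4 \<Rightarrow> complex"
  assumes proj: "\<And>U K. integrable lborel U \<Longrightarrow> finite K \<Longrightarrow> K \<subseteq> int_lattice \<Longrightarrow>
      (\<Sum>k\<in>K. (cmod (LINT \<xi>|lborel. complex_of_real (\<psi> (\<xi> - k)) * U \<xi>))\<^sup>2) \<le>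
      C * (LINT y|lborel. cauchy_weight 1 y ^ 3 * (cmod (fourier_raw U y))\<^sup>2)"
    and "C > 0" and supp: "\<And>\<xi>. 2 \<le> norm \<xi> \<Longrightarrow> \<psi> \<xi> = 0"
    and f: "has_fourier_transform f (fourier f)" and rad: "radial f"
    and B: "(\<integral>\<^sup>+\<xi>. ennreal ((cmod (fourier f \<xi>))\<^sup>2) \<partial>lborel) \<le> ennreal B" "0 \<le> B"
    and K: "finite K" "K \<subseteq> int_lattice"
  shows "norm x ^ 3 * (\<Sum>k\<in>K. (cmod (unit_proj \<psi> k f x))\<^sup>2) \<le> 8 * C * cauchy_sum ^ 3 * B"
proof -
  let ?g = "fourier f"
  have [measurable]: "?g \<in> borel_measurable borel" and g2: "integrable lborel (\<lambda>\<xi>. (cmod (?g \<xi>))\<^sup>2)"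
    using f by (auto simp: has_fourier_transform_def square_integrable_def)
  \<comment> \<open>For every \<open>k\<close> in \<open>K\<close> the ball of radius 2 around
    \<open>k\<close>, outside which \<open>\<psi> (\<xi> - k)\<close> vanishes, lies in the ball of
    radius \<open>R\<close>. Inserting 0 covers empty \<open>K\<close>.\<close>
  define R where "R = 2 + Max (insert 0 (norm ` K))"
  have R: "norm k + 2 \<le> R" if "k \<in> K" for k
    using that K(1) by (simp add: R_def)
  define u where "u \<xi> = indicator (ball 0 R) \<xi> * ?g \<xi>" for \<xi>
  define U where "U \<xi> = cis (x \<bullet> \<xi>) * u \<xi>" for \<xi>
  have [measurable]: "ball 0 R \<in> sets borel"
    by simp
  have u_meas [measurable]: "u \<in> borel_measurable borel"
    unfolding u_def[abs_def] by measurable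
  have fin: "emeasure lborel (ball (0 :: real ^ 4) R) < \<infinity>"
    by (rule emeasure_bounded_finite) simp
  have u: "integrable lborel u"
  proof (rule Bochner_Integration.integrable_bound)
    show "integrable lborel (\<lambda>\<xi>. indicator (ball 0 R) \<xi> + (cmod (?g \<xi>))\<^sup>2)"
      by (intro Bochner_Integration.integrable_add g2 integrable_real_indicator fin) simp
    \<comment> \<open>A square integrable function is integrable on a bounded set.\<close>
    have "cmod (u \<xi>) \<le> indicator (ball 0 R) \<xi> + (cmod (?g \<xi>))\<^sup>2" for \<xi>
    proof -
      have "2 * cmod (?g \<xi>) \<le> 1 + (cmod (?g \<xi>))\<^sup>2"
        using sum_squares_bound[of 1 "cmod (?g \<xi>)"] by simp
      then have "cmod (?g \<xi>) \<le> 1 + (cmod (?g \<xi>))\<^sup>2"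
        using norm_ge_zero[of "?g \<xi>"] by linarith
      then show ?thesis
        by (auto simp: u_def indicator_def)
    qed
    then show "AE \<xi> in lborel. norm (u \<xi>) \<le> norm (indicator (ball 0 R) \<xi> + (cmod (?g \<xi>))\<^sup>2)"
      by simp
  qed simp
  have U: "integrable lborel U"
    by (rule Bochner_Integration.integrable_bound[OF u]) (auto simp: U_def[abs_def] norm_mult)
  have uT: "AE \<xi> in lborel. u (T \<xi>) = u \<xi>" if T: "orthogonal_transformation T" for T
    using has_fourier_transform_orthogonal[OF f rad T]
    by eventually_elim (simp add: u_def indicator_def orthogonal_transformation_norm[OF T])
  \<comment> \<open>Up to a power of \<open>2 * pi\<close>, the inverse transform of the truncation,
    in the role of \<open>f\<close>.\<close>
  define V where "V z = fourier_raw u (- z)" for z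
  have [measurable]: "V \<in> borel_measurable borel"
    unfolding V_def[abs_def] by measurable
  have VT: "V (T z) = V z" if T: "orthogonal_transformation T" for T z
    using fourier_raw_orthogonal[OF T u_meas uT[OF T], of "- z"]
    by (simp add: V_def linear_neg orthogonal_transformation_linear[OF T])
  \<comment> \<open>The phase \<open>cis (x \<bullet> \<xi>)\<close> in \<open>U\<close> becomes a
    translation by \<open>x\<close>.\<close>
  have FU: "fourier_raw U y = V (x - y)" for y
    unfolding fourier_raw_def V_def U_def
    by (intro Bochner_Integration.integral_cong refl)
       (simp add: cis_mult inner_diff_left mult.commute mult.left_commute)
  let ?J = "LINT y|lborel. cauchy_weight 1 y ^ 3 * (cmod (fourier_raw U y))\<^sup>2"
  let ?I = "\<integral>\<^sup>+z. ennreal ((cmod (V z))\<^sup>2) \<partial>lborel"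
  have "?I = (\<integral>\<^sup>+y. ennreal ((cmod (fourier_raw u y))\<^sup>2) \<partial>lborel)"
    using nn_integral_lborel_reflect[of "\<lambda>y. ennreal ((cmod (fourier_raw u y))\<^sup>2)" 0] by (simp add: V_def)
  also have "\<dots> \<le> ennreal ((2 * pi) ^ 4) * (\<integral>\<^sup>+\<xi>. ennreal ((cmod (u \<xi>))\<^sup>2) \<partial>lborel)"
    using fourier_raw_square_le[OF u] by simp
  also have "(\<integral>\<^sup>+\<xi>. ennreal ((cmod (u \<xi>))\<^sup>2) \<partial>lborel) \<le> (\<integral>\<^sup>+\<xi>. ennreal ((cmod (?g \<xi>))\<^sup>2) \<partial>lborel)"
    by (intro nn_integral_mono) (auto simp: u_def indicator_def)
  also note B(1)
  finally have I: "?I \<le> ennreal ((2 * pi) ^ 4) * ennreal B"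
    by (simp add: mult_left_mono)
  have "integrable lborel (\<lambda>y. cauchy_weight 1 y ^ 3 * (cmod (fourier_raw U y))\<^sup>2)"
  proof (rule Bochner_Integration.integrable_bound[OF weighted_fourier_raw(1)[OF U zero_less_one]])
    show "AE y in lborel. norm (cauchy_weight 1 y ^ 3 * (cmod (fourier_raw U y))\<^sup>2) \<le>
        norm (cauchy_weight 1 y * (cmod (fourier_raw U y))\<^sup>2)"
    proof (rule AE_I2)
      fix y :: "real ^ 4"
      have "cauchy_weight 1 y ^ 3 \<le> cauchy_weight 1 y ^ 1"
        using cauchy_weight_bounds[of 1 y] by (intro power_decreasing) auto
      then show "norm (cauchy_weight 1 y ^ 3 * (cmod (fourier_raw U y))\<^sup>2) \<le>
        norm (cauchy_weight 1 y * (cmod (fourier_raw U y))\<^sup>2)"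
        using cauchy_weight_bounds(1)[of 1 y] by (simp add: abs_mult mult_right_mono)
    qed
  qed (simp add: FU)
  then have "ennreal ?J = (\<integral>\<^sup>+y. ennreal (cauchy_weight 1 y ^ 3 * (cmod (V (x - y)))\<^sup>2) \<partial>lborel)"
    unfolding FU by (intro nn_integral_eq_integral[symmetric]) (auto simp: cauchy_weight_bounds)
  also have "\<dots> \<le> (\<integral>\<^sup>+y. ennreal ((cmod (V (x - y)))\<^sup>2 * (1 / (1 + (norm y)\<^sup>2)) ^ 3) \<partial>lborel)"
  proof (intro nn_integral_mono ennreal_leI)
    fix y :: "real ^ 4"
    have "cauchy_weight 1 y ^ 3 \<le> (1 / (1 + (norm y)\<^sup>2)) ^ 3"
      by (intro power_mono cauchy_weight_le_radial cauchy_weight_bounds)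
    then show "cauchy_weight 1 y ^ 3 * (cmod (V (x - y)))\<^sup>2 \<le> (cmod (V (x - y)))\<^sup>2 * (1 / (1 + (norm y)\<^sup>2)) ^ 3"
      by (subst mult.commute) (intro mult_left_mono, auto)
  qed
  also have "\<dots> = (\<integral>\<^sup>+z. ennreal ((cmod (V z))\<^sup>2 * (1 / (1 + (norm (x - z))\<^sup>2)) ^ 3) \<partial>lborel)"
    using nn_integral_lborel_reflect[of "\<lambda>z. ennreal ((cmod (V z))\<^sup>2 * (1 / (1 + (norm (x - z))\<^sup>2)) ^ 3)" x]
    by simp
  finally have "ennreal ((norm x / 2) ^ 3) * ennreal ?J \<le> 
      ennreal ((norm x / 2) ^ 3) * (\<integral>\<^sup>+z. ennreal ((cmod (V z))\<^sup>2 * (1 / (1 + (norm (x - z))\<^sup>2)) ^ 3) \<partial>lborel)"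
    by (rule mult_left_mono) simp
  also have "\<dots> \<le> ennreal (cauchy_sum ^ 3) * ?I"
    by (rule radial_weight_average) (auto simp: VT)
  also have "\<dots> \<le> ennreal (cauchy_sum ^ 3) * (ennreal ((2 * pi) ^ 4) * ennreal B)"
    by (intro mult_left_mono I) simp
  also have "\<dots> = ennreal (cauchy_sum ^ 3 * ((2 * pi) ^ 4 * B))"
    using cauchy_sum_nonneg B(2) by (simp add: ennreal_mult[symmetric])
  also have "ennreal ((norm x / 2) ^ 3) * ennreal ?J = ennreal ((norm x / 2) ^ 3 * ?J)"
    by (rule ennreal_mult'[symmetric]) simp
  finally have J: "(norm x / 2) ^ 3 * ?J \<le> cauchy_sum ^ 3 * ((2 * pi) ^ 4 * B)"
    using cauchy_sum_nonneg B(2) by (subst (asm) ennreal_le_iff) auto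
  have up: "unit_proj \<psi> k f x = complex_of_real ((1 / sqrt (2 * pi)) ^ 4) * (LINT \<xi>|lborel. complex_of_real (\<psi> (\<xi> - k)) * U \<xi>)"
    if "k \<in> K" for k
  proof -
    have eq: "cis (x \<bullet> \<xi>) * (complex_of_real (\<psi> (\<xi> - k)) * ?g \<xi>) = complex_of_real (\<psi> (\<xi> - k)) * U \<xi>" for \<xi>
    proof (cases "norm \<xi> < R")
      case False
      then have "2 \<le> norm (\<xi> - k)"
        using R[OF that] norm_triangle_sub[of \<xi> k] by simp
      then show ?thesis using supp by simp
    qed (simp add: U_def u_def)
    show ?thesis
      unfolding unit_proj_def inverse_fourier_integral_def eq by simp
  qed
  \<comment> \<open>The squared unitary constant in dimension 4; it cancels the
    \<open>(2 * pi) ^ 4\<close> from \<open>fourier_raw_square_le\<close>.\<close>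
  have c: "((1 / sqrt (2 * pi)) ^ 4)\<^sup>2 = 1 / (2 * pi) ^ 4"
  proof -
    have "((1 / sqrt (2 * pi)) ^ 4)\<^sup>2 = ((1 / sqrt (2 * pi))\<^sup>2) ^ 4"
      by (simp only: power_mult[symmetric] mult.commute)
    then show ?thesis by (simp add: power_divide)
  qed
  have "(\<Sum>k\<in>K. (cmod (unit_proj \<psi> k f x))\<^sup>2) =
      (\<Sum>k\<in>K. 1 / (2 * pi) ^ 4 * (cmod (LINT \<xi>|lborel. complex_of_real (\<psi> (\<xi> - k)) * U \<xi>))\<^sup>2)"
  proof (rule sum.cong[OF refl])
    fix k assume "k \<in> K"
    show "(cmod (unit_proj \<psi> k f x))\<^sup>2 = 1 / (2 * pi) ^ 4 * (cmod (LINT \<xi>|lborel. complex_of_real (\<psi> (\<xi> - k)) * U \<xi>))\<^sup>2"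
      unfolding up[OF \<open>k \<in> K\<close>] norm_mult power_mult_distrib norm_of_real power2_abs c ..
  qed
  also have "\<dots> = 1 / (2 * pi) ^ 4 * (\<Sum>k\<in>K. (cmod (LINT \<xi>|lborel. complex_of_real (\<psi> (\<xi> - k)) * U \<xi>))\<^sup>2)"
    by (rule sum_distrib_left[symmetric])
  also have "\<dots> \<le> 1 / (2 * pi) ^ 4 * (C * ?J)"
    by (intro mult_left_mono proj[OF U K]) simp
  finally have "norm x ^ 3 * (\<Sum>k\<in>K. (cmod (unit_proj \<psi> k f x))\<^sup>2) \<le> norm x ^ 3 * (1 / (2 * pi) ^ 4 * (C * ?J))"
    by (intro mult_left_mono) auto
  \<comment> \<open>The 8 undoes the halving in \<open>(norm x / 2) ^ 3\<close>.\<close>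
  also have "\<dots> = 8 * C / (2 * pi) ^ 4 * ((norm x / 2) ^ 3 * ?J)"
    by (simp add: power_divide)
  also have "\<dots> \<le> 8 * C / (2 * pi) ^ 4 * (cauchy_sum ^ 3 * ((2 * pi) ^ 4 * B))"
    using \<open>C > 0\<close> by (intro mult_left_mono J) auto
  also have "\<dots> = 8 * C * cauchy_sum ^ 3 * B"
    by simp
  finally show ?thesis .
qed

theorem lemma2p2:
  fixes \<psi> :: "real ^ 4 \<Rightarrow> real" and s :: real
  assumes "smooth \<psi>"
    and "closure (support_on UNIV \<psi>) \<subseteq> ball 0 2"
    and "\<And>\<xi>. \<psi> (- \<xi>) = \<psi> \<xi>"
    and "\<And>\<xi>. 0 \<le> \<psi> \<xi>"
    and "\<And>\<xi>. ((\<lambda>k. \<psi> (\<xi> - k)) has_sum 1) int_lattice"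
    and "s > 0"
  shows "\<exists>C>0. \<forall>f\<in>sobolev s. radial f \<longrightarrow>
    esssup lborel (\<lambda>x. ennreal (norm x powr (3/2)) * square_function \<psi> f x)
      \<le> ennreal (C * sobolev_norm s f)"
proof -
  have supp: "\<psi> \<xi> = 0" if "2 \<le> norm \<xi>" for \<xi>
  proof (rule ccontr)
    assume "\<psi> \<xi> \<noteq> 0"
    then have "\<xi> \<in> closure (support_on UNIV \<psi>)"
      by (intro subsetD[OF closure_subset]) (simp add: support_on_def)
    with assms(2) that show False by auto
  qed
  have "test_function \<psi>"
    using assms(1) supp unfolding test_function_def by (metis less_imp_le)
  then obtain C where C: "C > 0"
    "\<And>U K. integrable lborel U \<Longrightarrow> finite K \<Longrightarrow> K \<subseteq> int_lattice \<Longrightarrow>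
      (\<Sum>k\<in>K. (cmod (LINT \<xi>|lborel. complex_of_real (\<psi> (\<xi> - k)) * U \<xi>))\<^sup>2) \<le>
      C * (LINT y|lborel. cauchy_weight 1 y ^ 3 * (cmod (fourier_raw U y))\<^sup>2)"
    using sum_projections_le by blast
  define D where "D = sqrt (8 * C * cauchy_sum ^ 3)"
  have D: "0 \<le> D" "D\<^sup>2 = 8 * C * cauchy_sum ^ 3"
    using C(1) cauchy_sum_nonneg by (simp_all add: D_def)
  show ?thesis
  \<comment> \<open>\<open>cauchy_sum\<close> is only known to be nonnegative; adding 1 makes the
    constant positive.\<close>
  proof (intro exI[of _ "D + 1"] conjI ballI impI)
    show "0 < D + 1" using D by simp
    fix f :: "real ^ 4 \<Rightarrow> complex"
    assume fs: "f \<in> sobolev s" and rad: "radial f"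
    note f = sobolev_fourier[OF fs \<open>s > 0\<close>]
    let ?B = "sobolev_norm s f"
    have B0: "0 \<le> ?B"
      by (simp add: sobolev_norm_def integral_nonneg_AE)
    have [measurable]: "square_function \<psi> f \<in> borel_measurable borel"
      using f(1) assms(1) by (intro square_function_measurable)
        (auto simp: has_fourier_transform_def square_integrable_def intro: borel_measurable_continuous_onI smooth_continuous)
    have le: "ennreal (norm x powr (3/2)) * square_function \<psi> f x \<le> ennreal ((D + 1) * ?B)" for x
    \<comment> \<open>At the origin the factor \<open>norm x powr (3/2)\<close> is 0, and in
      \<open>ennreal\<close> it annihilates even an infinite square function.\<close>
    proof (cases "x = 0")
      case False
      let ?r = "norm x"
      have r: "0 < ?r" using False by simp
      have pw: "(?r powr (3/2))\<^sup>2 = ?r ^ 3"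
        using r by (simp add: power2_eq_square flip: powr_add)
      have "(\<Sum>k\<in>K. ennreal ((cmod (unit_proj \<psi> k f x))\<^sup>2)) \<le> ennreal ((D * ?B / ?r powr (3/2))\<^sup>2)"
        if K: "finite K" "K \<subseteq> int_lattice" for K
      proof -
        have "?r ^ 3 * (\<Sum>k\<in>K. (cmod (unit_proj \<psi> k f x))\<^sup>2) \<le> (D * ?B)\<^sup>2"
          using sum_unit_proj_le[OF C(2,1) supp f(1) rad f(2) _ K] by (simp add: D(2) power_mult_distrib)
        then have "(\<Sum>k\<in>K. (cmod (unit_proj \<psi> k f x))\<^sup>2) \<le> (D * ?B / ?r powr (3/2))\<^sup>2"
          using r by (simp only: power_divide pw) (simp add: pos_le_divide_eq mult.commute)
        then show ?thesis
          by (subst sum_ennreal) (auto intro: ennreal_leI)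
      qed
      \<comment> \<open>The bound on finite sums is uniform in \<open>K\<close>, so it passes to
        their supremum.\<close>
      then have "(\<Sum>\<^sub>\<infinity>k\<in>int_lattice. ennreal ((cmod (unit_proj \<psi> k f x))\<^sup>2)) \<le> ennreal ((D * ?B / ?r powr (3/2))\<^sup>2)"
        by (subst nonneg_infsum_complete) (auto intro: SUP_least)
      then have "square_function \<psi> f x \<le> ennreal (D * ?B / ?r powr (3/2))"
        unfolding square_function_def using ennreal_sqrt_le D(1) B0 by fastforce
      then have "ennreal (?r powr (3/2)) * square_function \<psi> f x \<le> ennreal (?r powr (3/2)) * ennreal (D * ?B / ?r powr (3/2))"
        by (rule mult_left_mono) simp
      also have "\<dots> = ennreal (D * ?B)"
        using r D(1) B0 by (subst ennreal_mult[symmetric]) auto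
      also have "\<dots> \<le> ennreal ((D + 1) * ?B)"
        using B0 by (intro ennreal_leI) (simp add: mult_right_mono)
      finally show ?thesis .
    qed simp
    show "esssup lborel (\<lambda>x. ennreal (norm x powr (3/2)) * square_function \<psi> f x) \<le> ennreal ((D + 1) * ?B)"
      by (rule esssup_I) (measurable, simp add: le)
  qed
qed

end
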